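(* Let $r\ge 2$, let $\nu$ be a partition with $|\nu|\le r$, let $1\le k\le r-1$ and let $\mathsf t\in\mathrm{Std}_r(\nu)$. If $\mathsf t_{k\leftrightarrow k+1}$ exists, then in the partition algebra $P_r(n)$ $$u_{\mathsf t}\,s_{k,k+1}=u_{\mathsf t_{k\leftrightarrow k+1}}+u_{\mathsf e_k(\mathsf t)}-u_{\mathsf e_k(\mathsf t_{k\leftrightarrow k+1})},$$ where $u_{\mathsf e_k(\mathsf v)}$ is interpreted as $0$ whenever $\mathsf e_k(\mathsf v)$ is undefined.
   Context: Partitions: $|\lambda|$ is the size, $\ell(\lambda)$ the number of nonzero parts, $[\lambda]_a=\lambda_1+\dots+\lambda_a$, $[\lambda]_0=0$. For $i\ge1$, $\pm\varepsilon_i$ means adding/removing a box in row $i$, and $\varepsilon_0=0$. Paths. $\mathrm{Std}_r(\nu)$ is the set of sequences $\mathsf t=(-\varepsilon_{i_1},+\varepsilon_{j_1},\dots,-\varepsilon_{i_r},+\varepsilon_{j_r})$, $i_k,j_k\in\mathbb Z_{\ge0}$, such that with $\mathsf t(0)=\varnothing$, $\mathsf t(k-\frac12)=\mathsf t(k-1)-\varepsilon_{i_k}$, $\mathsf t(k)=\mathsf t(k-\frac12)+\varepsilon_{j_k}$, all $\mathsf t(k),\mathsf t(k-\frac12)$ are partitions and $\mathsf t(r)=\nu$ (paths in the branching graph of the partition algebras). The pair $(-\varepsilon_{i_k},+\varepsilon_{j_k})$ is the $k$-th integral step. $\mathsf t_{k\leftrightarrow k+1}$ is the sequence obtained by interchanging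 the $k$-th and $(k+1)$-th integral steps; it exists if it lies in $\mathrm{Std}_r(\nu)$. If $j_k=i_{k+1}=u\ge1$ (i.e. $\mathsf t(k-\frac12)\xrightarrow{+\varepsilon_u}\mathsf t(k)\xrightarrow{-\varepsilon_u}\mathsf t(k+\frac12)$), then $\mathsf e_k(\mathsf t)\in\mathrm{Std}_r(\nu)$ is the path agreeing with $\mathsf t$ except that $\mathsf e_k(\mathsf t)(k)=\mathsf t(k-\frac12)+\varepsilon_L$ with $L=\ell(\mathsf t(k-\frac12))+1$ (i.e. $j_k$ and $i_{k+1}$ are replaced by $L$); otherwise $\mathsf e_k(\mathsf t)$ is undefined. Partition algebra. $P_r(n)$ (over $\mathbb Q$, $n$ an integer) has basis the set partitions of $\{1,\dots,r,\bar1,\dots,\bar r\}$, drawn as diagrams with northern vertices $\bar1,\dots,\bar r$ and southern vertices $1,\dots,r$; $xy$ is obtained by placing $x$ above $y$, identifying southern vertices of $x$ with northern vertices of $y$, deleting the $t$ components consisting only of middle vertices and multiplying by $n^t$. $s_{k,k+1}$ is the diagram with blocks $\{\bar k,k+1\},\{\overline{k+1},k\}$ and $\{\bar i,i\}$ otherwise; $p_k$ has blocks $\{\bar k\},\{k\}$ and $\{\bar i,i\}$ otherwise; $p_{k+\frac12}$ has block $\{k,k+1,\bar k,\overline{k+1}\}$ and $\{\bar i,i\}$ otherwise. Let $e^{(l)}_k=p_{k-l+1}\cdots p_k$, $e^{(l)}_{k+\frac12}=p_{k-l+\frac32}\cdots p_{k+\frac12}$ ($l$ factors), with $e^{(l)}_k=e^{(l)}_{k-\frac12}=1$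 if $k=0$ or $l=0$. For $1\le l\le k$, $s_{l,k}=s_{l,l+1}s_{l+1,l+2}\cdots s_{k-1,k}$; for $k<l$, $s_{l,k}=s_{k,l}^{-1}$; $s_{l,k}=1$ if $l=0$ or $k=0$. For a partition $\gamma$ and $b\ge1$ let $M_{\gamma,b}=\sum_{i=0}^{\gamma_b-1}s_{[\gamma]_b-i,[\gamma]_b}$, and $M_{\gamma,0}=1$. For $\mathsf t\in\mathrm{Std}_r(\nu)$ and $0\le k<r$ with $\mathsf t(k)=\alpha\xrightarrow{-\varepsilon_a}\mathsf t(k+\frac12)=\beta\xrightarrow{+\varepsilon_b}\mathsf t(k+1)=\gamma$, put $u_{\mathsf t(k)\to\mathsf t(k+\frac12)}=e^{(k-|\beta|)}_{k+\frac12}s_{|\alpha|,[\alpha]_a}$ and $u_{\mathsf t(k+\frac12)\to\mathsf t(k+1)}=e^{(k+1-|\gamma|)}_{k+1}M_{\gamma,b}\,s_{[\gamma]_b,|\gamma|}$, and $u_{\mathsf t}=u_{\mathsf t(r-\frac12)\to\mathsf t(r)}\cdots u_{\mathsf t(\frac12)\to\mathsf t(1)}u_{\mathsf t(0)\to\mathsf t(\frac12)}$. *)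

theory Defs
  imports Complex_Main "HOL-Library.Disjoint_Sets" "HOL-Library.Function_Algebras"
begin

text \<open>A partition is a function nat => nat; rows are indexed from 1, value at 0 is 0.\<close>

definition is_part :: "(nat \<Rightarrow> nat) \<Rightarrow> bool" where
  "is_part lam \<longleftrightarrow> lam 0 = 0 \<and> (\<forall>i\<ge>1. lam (Suc i) \<le> lam i) \<and> finite {i. lam i \<noteq> 0}"

definition psize :: "(nat \<Rightarrow> nat) \<Rightarrow> nat" where
  "psize lam = sum lam {i. lam i \<noteq> 0}"

definition plen :: "(nat \<Rightarrow> nat) \<Rightarrow> nat" where
  "plen lam = card {i. i \<ge> 1 \<and> lam i \<noteq> 0}"

definition pprefix :: "(nat \<Rightarrow> nat) \<Rightarrow> nat \<Rightarrow> nat" where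
  "pprefix lam a = sum lam {1..a}"

definition pempty :: "nat \<Rightarrow> nat" where
  "pempty = (\<lambda>_. 0)"

definition addbox :: "nat \<Rightarrow> (nat \<Rightarrow> nat) \<Rightarrow> (nat \<Rightarrow> nat)" where
  "addbox i lam = (if i = 0 then lam else lam(i := Suc (lam i)))"

text \<open>-eps_i (eps_0 = 0); only meaningful when i = 0 or lam i > 0, which the path
  condition requires explicitly.\<close>
definition rembox :: "nat \<Rightarrow> (nat \<Rightarrow> nat) \<Rightarrow> (nat \<Rightarrow> nat)" where
  "rembox i lam = (if i = 0 then lam else lam(i := lam i - 1))"

text \<open>A path t is a list of integral steps (i_k, j_k), k = 1..r (list index k-1).\<close>

definition pstate :: "(nat \<times> nat) list \<Rightarrow> nat \<Rightarrow> (nat \<Rightarrow> nat)" where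
  "pstate t k = foldl (\<lambda>lam (i, j). addbox j (rembox i lam)) pempty (take k t)"

text \<open>hstate t k = t(k + 1/2).\<close>
definition hstate :: "(nat \<times> nat) list \<Rightarrow> nat \<Rightarrow> (nat \<Rightarrow> nat)" where
  "hstate t k = rembox (fst (t ! k)) (pstate t k)"

definition Std :: "nat \<Rightarrow> (nat \<Rightarrow> nat) \<Rightarrow> (nat \<times> nat) list set" where
  "Std r nu = {t. length t = r \<and>
     (\<forall>k<r. (fst (t ! k) = 0 \<or> 0 < pstate t k (fst (t ! k)))
            \<and> is_part (hstate t k) \<and> is_part (pstate t (Suc k)))
     \<and> pstate t r = nu}"

definition swap_steps :: "(nat \<times> nat) list \<Rightarrow> nat \<Rightarrow> (nat \<times> nat) list" where
  "swap_steps t k = t[k - 1 := t ! k, k := t ! (k - 1)]"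

definition ek_path :: "(nat \<times> nat) list \<Rightarrow> nat \<Rightarrow> (nat \<times> nat) list option" where
  "ek_path t k =
    (if snd (t ! (k - 1)) = fst (t ! k) \<and> fst (t ! k) \<ge> 1
     then (let L = plen (hstate t (k - 1)) + 1
           in Some (t[k - 1 := (fst (t ! (k - 1)), L), k := (L, snd (t ! k))]))
     else None)"

text \<open>Vertices: (True, i) is the northern vertex bar i, (False, i) the southern vertex i.\<close>

definition verts :: "nat \<Rightarrow> (bool \<times> nat) set" where
  "verts r = UNIV \<times> {1..r}"

definition setparts :: "nat \<Rightarrow> (bool \<times> nat) set set set" where
  "setparts r = {d. partition_on (verts r) d}"

text \<open>Elements of P_r(n): rational coefficient functions on set partitions
  (coefficients outside setparts r are irrelevant and are produced as 0 by products).\<close>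
type_synonym pa = "(bool \<times> nat) set set \<Rightarrow> rat"

text \<open>Stacking x above y: level 0 = northern row of x, level 1 = middle row,
  level 2 = southern row of y.\<close>
definition emb_top :: "bool \<times> nat \<Rightarrow> nat \<times> nat" where
  "emb_top v = (if fst v then (0, snd v) else (1, snd v))"

definition emb_bot :: "bool \<times> nat \<Rightarrow> nat \<times> nat" where
  "emb_bot v = (if fst v then (1, snd v) else (2, snd v))"

definition dcomp :: "(bool \<times> nat) set set \<Rightarrow> (bool \<times> nat) set set
                     \<Rightarrow> (bool \<times> nat) set set \<times> nat" where
  "dcomp x y =
    (let Bs = (image emb_top ` x) \<union> (image emb_bot ` y);
         R = {(a, c). \<exists>b\<in>Bs. a \<in> b \<and> c \<in> b};
         Cs = (\<Union>Bs) // (R\<^sup>+);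
         mid = {v. fst v = (1::nat)}
     in ({(\<lambda>v. (fst v = 0, snd v)) ` (c - mid) | c. c \<in> Cs \<and> \<not> c \<subseteq> mid},
         card {c \<in> Cs. c \<subseteq> mid}))"

definition pa_mult :: "int \<Rightarrow> nat \<Rightarrow> pa \<Rightarrow> pa \<Rightarrow> pa" where
  "pa_mult n r f g = (\<lambda>d. \<Sum>x\<in>setparts r. \<Sum>y\<in>setparts r.
      if fst (dcomp x y) = d then f x * g y * of_int n ^ snd (dcomp x y) else 0)"

definition pa_basis :: "(bool \<times> nat) set set \<Rightarrow> pa" where
  "pa_basis d = (\<lambda>e. if e = d then 1 else 0)"

definition pa_one :: "nat \<Rightarrow> pa" where
  "pa_one r = pa_basis {{(True, i), (False, i)} | i. i \<in> {1..r}}"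

definition pa_prod :: "int \<Rightarrow> nat \<Rightarrow> pa list \<Rightarrow> pa" where
  "pa_prod n r xs = foldr (pa_mult n r) xs (pa_one r)"

definition s_adj :: "nat \<Rightarrow> nat \<Rightarrow> pa" where
  "s_adj r k = pa_basis ({{(True, k), (False, Suc k)}, {(True, Suc k), (False, k)}}
      \<union> {{(True, i), (False, i)} | i. i \<in> {1..r} - {k, Suc k}})"

definition p_int :: "nat \<Rightarrow> nat \<Rightarrow> pa" where
  "p_int r k = pa_basis ({{(True, k)}, {(False, k)}}
      \<union> {{(True, i), (False, i)} | i. i \<in> {1..r} - {k}})"

text \<open>p_half r k = p_{k+1/2}\<close>
definition p_half :: "nat \<Rightarrow> nat \<Rightarrow> pa" where
  "p_half r k = pa_basis ({{(True, k), (True, Suc k), (False, k), (False, Suc k)}}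
      \<union> {{(True, i), (False, i)} | i. i \<in> {1..r} - {k, Suc k}})"

definition e_int :: "int \<Rightarrow> nat \<Rightarrow> nat \<Rightarrow> nat \<Rightarrow> pa" where
  "e_int n r l k = (if k = 0 \<or> l = 0 then pa_one r
     else pa_prod n r (map (p_int r) [Suc k - l..<Suc k]))"

text \<open>e_half n r l k = e^{(l)}_{k+1/2} = p_{k-l+3/2} ... p_{k+1/2}
  (it equals 1 when l = 0; k + 1/2 is never 0).\<close>
definition e_half :: "int \<Rightarrow> nat \<Rightarrow> nat \<Rightarrow> nat \<Rightarrow> pa" where
  "e_half n r l k = (if l = 0 then pa_one r
     else pa_prod n r (map (p_half r) [Suc k - l..<Suc k]))"

text \<open>s_{l,k}: for 1 <= l <= k the product s_{l,l+1} ... s_{k-1,k}; for k < l the inverse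
  of s_{k,l}, i.e. s_{l-1,l} ... s_{k,k+1} (each s_{i,i+1} is an involution);
  1 if l = 0 or k = 0.\<close>
definition s_gen :: "int \<Rightarrow> nat \<Rightarrow> nat \<Rightarrow> nat \<Rightarrow> pa" where
  "s_gen n r l k = (if l = 0 \<or> k = 0 then pa_one r
     else if l \<le> k then pa_prod n r (map (s_adj r) [l..<k])
     else pa_prod n r (rev (map (s_adj r) [k..<l])))"

definition M_elem :: "int \<Rightarrow> nat \<Rightarrow> (nat \<Rightarrow> nat) \<Rightarrow> nat \<Rightarrow> pa" where
  "M_elem n r gam b = (if b = 0 then pa_one r
     else (\<Sum>i<gam b. s_gen n r (pprefix gam b - i) (pprefix gam b)))"

definition u_down :: "int \<Rightarrow> nat \<Rightarrow> (nat \<times> nat) list \<Rightarrow> nat \<Rightarrow> pa" where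
  "u_down n r t k =
    (let alpha = pstate t k; beta = hstate t k; a = fst (t ! k)
     in pa_mult n r (e_half n r (k - psize beta) k) (s_gen n r (psize alpha) (pprefix alpha a)))"

definition u_up :: "int \<Rightarrow> nat \<Rightarrow> (nat \<times> nat) list \<Rightarrow> nat \<Rightarrow> pa" where
  "u_up n r t k =
    (let gam = pstate t (Suc k); b = snd (t ! k)
     in pa_mult n r (pa_mult n r (e_int n r (Suc k - psize gam) (Suc k)) (M_elem n r gam b))
          (s_gen n r (pprefix gam b) (psize gam)))"

fun u_prod :: "int \<Rightarrow> nat \<Rightarrow> (nat \<times> nat) list \<Rightarrow> nat \<Rightarrow> pa" where
  "u_prod n r t 0 = pa_one r"
| "u_prod n r t (Suc k) = pa_mult n r (pa_mult n r (u_up n r t k) (u_down n r t k)) (u_prod n r t k)"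

definition u_path :: "int \<Rightarrow> nat \<Rightarrow> (nat \<times> nat) list \<Rightarrow> pa" where
  "u_path n r t = u_prod n r t r"

definition u_opt :: "int \<Rightarrow> nat \<Rightarrow> (nat \<times> nat) list option \<Rightarrow> pa" where
  "u_opt n r ot = (case ot of None \<Rightarrow> 0 | Some t \<Rightarrow> u_path n r t)"

end

theory Submission
  imports Defs "HOL-Combinatorics.Transposition"
begin

text \<open>The element u_t is multiplicity free: it is the sum of all diagrams obtained as follows.
  Every southern vertex i whose step removes a box from row a > 0 is joined to a smaller vertex, its
  predecessor, whose step added a box to row a, distinct vertices having distinct predecessors;
  vertices that removed nothing start a new block. The blocks whose last vertex added a box to
  row b > 0 are joined to the northern vertices of row b in all possible ways, and the remaining
  northern vertices are isolated. No component is ever deleted, so n plays no role.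

  Multiplication by the transposition of k and k + 1 exchanges these diagrams for t and for the
  swapped path as long as k is not the predecessor of k + 1, and it fixes the diagrams in which it
  is. The latter are exactly the diagrams of e_k(t), because there the row added at step k
  and removed at step k + 1 was empty.

  A diagram is handled through the sets of vertices that are unions of blocks, viewed as pairs
  (A, B) of sets of northern and southern indices. The number of compatible subsets
  of the middle row of a stack of two diagrams is 2 to the number of deleted components.\<close>

section \<open>Diagrams and saturated vertex sets\<close>

text \<open>Stacking becomes composition of relations: (A, B) is saturated for a stack exactly when
  some set m of middle vertices fits both factors, up to counting the m. Uniqueness of m for every
  (A, B) does two things at once: it identifies the product diagram and shows that the exponent of n
  is 0. Uniqueness survives the cuts made by the factors e because the preceding half step has glued
  every northern vertex outside the current shape to the block of the newest southern vertex, so a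
  cut never splits off a middle component.

  The free choice of predecessors comes from M. A removal always takes the vertex at the end of its
  row, but an added vertex is put at every place of its row, so every order within the rows occurs
  once, and with it every choice of links.

  Relabelling by a transposition can fail only at a link from k + 1 to k, the one link whose
  direction it would reverse. For e_k(t), the vertices that added to row L before k are already used
  up by the removals from row L up to k, so k + 1 is forced to choose k.\<close>

definition saturated :: "'a set set \<Rightarrow> 'a set \<Rightarrow> bool" where
  "saturated d S \<longleftrightarrow> (\<forall>B\<in>d. B \<subseteq> S \<or> B \<inter> S = {})"

definition colouring :: "nat set \<Rightarrow> nat set \<Rightarrow> (bool \<times> nat) set" where
  "colouring A B = {True} \<times> A \<union> {False} \<times> B"

lemma mem_colouring [simp]: "(b, i) \<in> colouring A B \<longleftrightarrow> (if b then i \<in> A else i \<in> B)"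
  by (auto simp: colouring_def)

text \<open>The levels 0, 1, 2 are those of \<open>emb_top\<close> and \<open>emb_bot\<close>, so m
  is read as a southern set by the upper diagram and as a northern set by the lower one.\<close>

definition stacked :: "nat set \<Rightarrow> nat set \<Rightarrow> nat set \<Rightarrow> (nat \<times> nat) set" where
  "stacked A m B = {0} \<times> A \<union> {1} \<times> m \<union> {2} \<times> B"

lemma mem_stacked: "(l, i) \<in> stacked A m B \<longleftrightarrow> l = 0 \<and> i \<in> A \<or> l = 1 \<and> i \<in> m \<or> l = 2 \<and> i \<in> B"
  by (auto simp: stacked_def)

definition block_rel :: "'a set set \<Rightarrow> ('a \<times> 'a) set" where
  "block_rel Bs = {(a, c). \<exists>b\<in>Bs. a \<in> b \<and> c \<in> b}"

lemma equiv_block_rel: "equiv (\<Union>Bs) ((block_rel Bs)\<^sup>+)"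
proof (rule equivI)
  have "block_rel Bs \<subseteq> \<Union>Bs \<times> \<Union>Bs"
    by (auto simp: block_rel_def)
  then show "(block_rel Bs)\<^sup>+ \<subseteq> \<Union>Bs \<times> \<Union>Bs"
    by (rule trancl_subset_Sigma)
  show "refl_on (\<Union>Bs) ((block_rel Bs)\<^sup>+)"
    by (rule refl_onI) (auto simp: block_rel_def intro!: r_into_trancl)
  show "sym ((block_rel Bs)\<^sup>+)"
    by (rule sym_trancl) (auto simp: sym_def block_rel_def)
qed (rule trans_trancl)

text \<open>A set that respects every generating block is constant along chains of overlapping
  blocks, and each nonempty block lies inside one class. This removes transitive closures from the
  later reasoning about saturated sets.\<close>

lemma saturated_classes:
  "saturated ((\<Union>Bs) // (block_rel Bs)\<^sup>+) S \<longleftrightarrow> saturated Bs S"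
proof
  assume L: "saturated ((\<Union>Bs) // (block_rel Bs)\<^sup>+) S"
  show "saturated Bs S"
    unfolding saturated_def
  proof
    fix B assume B: "B \<in> Bs"
    show "B \<subseteq> S \<or> B \<inter> S = {}"
    proof (cases "B = {}")
      case False
      then obtain a where a: "a \<in> B" by auto
      let ?c = "(block_rel Bs)\<^sup>+ `` {a}"
      have "?c \<in> (\<Union>Bs) // (block_rel Bs)\<^sup>+"
        using a B by (intro quotientI) auto
      moreover have "B \<subseteq> ?c"
        using a B by (auto simp: block_rel_def intro!: r_into_trancl)
      ultimately show ?thesis
        using L unfolding saturated_def by blast
    qed simp
  qed
next
  assume R: "saturated Bs S"
  have step: "a \<in> S \<longleftrightarrow> c \<in> S" if "(a, c) \<in> (block_rel Bs)\<^sup>+" for a c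
    using that
  proof induction
    case (base y)
    then show ?case using R by (auto simp: block_rel_def saturated_def)
  next
    case (step y z)
    then show ?case using R by (fastforce simp: block_rel_def saturated_def)
  qed
  show "saturated ((\<Union>Bs) // (block_rel Bs)\<^sup>+) S"
    unfolding saturated_def
  proof
    fix c assume "c \<in> (\<Union>Bs) // (block_rel Bs)\<^sup>+"
    then obtain a where "c = (block_rel Bs)\<^sup>+ `` {a}" by (rule quotientE)
    then show "c \<subseteq> S \<or> c \<inter> S = {}" using step by blast
  qed
qed

section \<open>Components of a stack of two diagrams\<close>

definition layers :: "(bool \<times> nat) set set \<Rightarrow> (bool \<times> nat) set set \<Rightarrow> (nat \<times> nat) set set" where
  "layers x y = (image emb_top ` x) \<union> (image emb_bot ` y)"

definition comps :: "(bool \<times> nat) set set \<Rightarrow> (bool \<times> nat) set set \<Rightarrow> (nat \<times> nat) set set" where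
  "comps x y = (\<Union>(layers x y)) // (block_rel (layers x y))\<^sup>+"

text \<open>The trace of a component on the two outer rows. A component inside the middle row has an
  empty trace and is one of those that \<open>dcomp\<close> counts instead.\<close>

definition outer :: "(nat \<times> nat) set \<Rightarrow> (bool \<times> nat) set" where
  "outer c = (\<lambda>v. (fst v = 0, snd v)) ` (c - {v. fst v = 1})"

lemma fst_dcomp: "fst (dcomp x y) = outer ` {c \<in> comps x y. \<not> c \<subseteq> {v. fst v = 1}}"
  and snd_dcomp: "snd (dcomp x y) = card {c \<in> comps x y. c \<subseteq> {v. fst v = 1}}"
  unfolding dcomp_def comps_def layers_def block_rel_def outer_def Let_def by auto

lemma layers_cover:
  assumes "x \<in> setparts r" "y \<in> setparts r"
  shows "\<Union>(layers x y) = {0, 1, 2} \<times> {1..r}"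
proof -
  have "\<Union>x = verts r" "\<Union>y = verts r"
    using assms by (auto simp: setparts_def partition_on_def)
  moreover have "\<Union>(layers x y) = emb_top ` (\<Union>x) \<union> emb_bot ` (\<Union>y)"
    by (auto simp: layers_def)
  ultimately have "\<Union>(layers x y) = emb_top ` verts r \<union> emb_bot ` verts r"
    by simp
  also have "\<dots> = {0, 1, 2} \<times> {1..r}"
  proof (intro equalityI subsetI)
    fix v :: "nat \<times> nat" assume v: "v \<in> {0, 1, 2} \<times> {1..r}"
    then obtain i where "v = emb_top (True, i) \<or> v = emb_top (False, i) \<or> v = emb_bot (False, i)"
      and "i \<in> {1..r}"
      by (auto simp: emb_top_def emb_bot_def)
    then show "v \<in> emb_top ` verts r \<union> emb_bot ` verts r"
      by (auto simp: verts_def)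
  qed (auto simp: verts_def emb_top_def emb_bot_def)
  finally show ?thesis .
qed

lemma comps_partition:
  assumes "x \<in> setparts r" "y \<in> setparts r"
  shows "partition_on ({0, 1, 2} \<times> {1..r}) (comps x y)"
  unfolding comps_def layers_cover[OF assms, symmetric]
  by (rule partition_on_quotient[OF equiv_block_rel])

lemma saturated_layers:
  "saturated (layers x y) (stacked A m B) \<longleftrightarrow>
     saturated x (colouring A m) \<and> saturated y (colouring m B)"
proof -
  have "emb_top v \<in> stacked A m B \<longleftrightarrow> v \<in> colouring A m" for v
    by (cases v) (auto simp: emb_top_def mem_stacked)
  then have t: "emb_top ` b \<subseteq> stacked A m B \<longleftrightarrow> b \<subseteq> colouring A m"
    "emb_top ` b \<inter> stacked A m B = {} \<longleftrightarrow> b \<inter> colouring A m = {}" for b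
    by blast+
  have "emb_bot v \<in> stacked A m B \<longleftrightarrow> v \<in> colouring m B" for v
    by (cases v) (auto simp: emb_bot_def mem_stacked)
  then have u: "emb_bot ` b \<subseteq> stacked A m B \<longleftrightarrow> b \<subseteq> colouring m B"
    "emb_bot ` b \<inter> stacked A m B = {} \<longleftrightarrow> b \<inter> colouring m B = {}" for b
    by blast+
  show ?thesis
    unfolding saturated_def layers_def ball_Un ball_simps t u ..
qed

lemma saturated_comps:
  "saturated (comps x y) (stacked A m B) \<longleftrightarrow>
     saturated x (colouring A m) \<and> saturated y (colouring m B)"
  unfolding comps_def saturated_classes by (rule saturated_layers)

lemma dcomp_setparts:
  assumes "x \<in> setparts r" "y \<in> setparts r"
  shows "fst (dcomp x y) \<in> setparts r"
proof -
  note P = comps_partition[OF assms]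
  \<comment> \<open>The flag \<open>fst v = 0\<close> tells the two outer rows apart only because
    every vertex has level 0, 1 or 2; the disjointness of traces rests on this.\<close>
  have lev: "fst v \<in> {0, 1, 2}" if "v \<in> c" "c \<in> comps x y" for v c
  proof -
    have "c \<subseteq> {0, 1, 2} \<times> {1..r}"
      unfolding partition_onD1[OF P] using that by (intro Union_upper)
    then show ?thesis using that by auto
  qed
  show ?thesis
    unfolding setparts_def fst_dcomp mem_Collect_eq
  proof (rule partition_onI)
    have "\<Union> (outer ` {c \<in> comps x y. \<not> c \<subseteq> {v. fst v = 1}}) = outer (\<Union>(comps x y))"
      by (auto simp: outer_def)
    also have "\<dots> = outer ({0, 1, 2} \<times> {1..r})"
      using partition_onD1[OF P] by simp
    also have "\<dots> = verts r"
    proof (intro equalityI subsetI)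
      fix v assume v: "v \<in> verts r"
      then have "v = (\<lambda>v. (fst v = 0, snd v)) (if fst v then 0 else 2 :: nat, snd v)"
        by (cases v) auto
      moreover have "(if fst v then 0 else 2 :: nat, snd v) \<in> {0, 1, 2} \<times> {1..r} - {v. fst v = 1}"
        using v by (auto simp: verts_def)
      ultimately show "v \<in> outer ({0, 1, 2} \<times> {1..r})"
        unfolding outer_def by blast
    qed (auto simp: outer_def verts_def)
    finally show "\<Union> (outer ` {c \<in> comps x y. \<not> c \<subseteq> {v. fst v = 1}}) = verts r" .
  next
    fix p q
    assume p: "p \<in> outer ` {c \<in> comps x y. \<not> c \<subseteq> {v. fst v = 1}}"
      and q: "q \<in> outer ` {c \<in> comps x y. \<not> c \<subseteq> {v. fst v = 1}}" and "p \<noteq> q"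
    then obtain c d where cd: "p = outer c" "q = outer d" "c \<in> comps x y" "d \<in> comps x y" "c \<noteq> d"
      by auto
    then have disj: "c \<inter> d = {}"
      using partition_onD2[OF P] by (auto dest: disjointD)
    have "v = w" if "v \<in> c" "w \<in> d" "fst v \<noteq> 1" "fst w \<noteq> 1"
      "(fst v = 0) = (fst w = 0)" "snd v = snd w" for v w
      using lev[OF that(1) cd(3)] lev[OF that(2) cd(4)] that by (cases v; cases w) auto
    note inj = this
    show "disjnt p q"
    proof (rule ccontr)
      assume "\<not> disjnt p q"
      then obtain u where u: "u \<in> outer c" "u \<in> outer d" by (auto simp: disjnt_iff cd)
      obtain v where v: "v \<in> c" "fst v \<noteq> 1" "u = (fst v = 0, snd v)"
        using u(1) by (auto simp: outer_def)
      obtain w where w: "w \<in> d" "fst w \<noteq> 1" "u = (fst w = 0, snd w)"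
        using u(2) by (auto simp: outer_def)
      have "v = w" using inj[OF v(1) w(1) v(2) w(2)] v(3) w(3) by simp
      then show False using v w disj by blast
    qed
  next
    show "{} \<notin> outer ` {c \<in> comps x y. \<not> c \<subseteq> {v. fst v = 1}}" by (auto simp: outer_def)
  qed
qed

section \<open>Counting the colourings of the middle row\<close>

definition middles :: "nat \<Rightarrow> (bool \<times> nat) set set \<Rightarrow> (bool \<times> nat) set set \<Rightarrow> nat set \<Rightarrow> nat set \<Rightarrow> nat set set" where
  "middles r x y A B = {m \<in> Pow {1..r}. saturated x (colouring A m) \<and> saturated y (colouring m B)}"

lemma outer_colouring:
  assumes "c \<subseteq> {0, 1, 2} \<times> {1..r}"
  shows "outer c \<subseteq> colouring A B \<longleftrightarrow> c - {v. fst v = 1} \<subseteq> stacked A {} B"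
    and "outer c \<inter> colouring A B = {} \<longleftrightarrow> (c - {v. fst v = 1}) \<inter> stacked A {} B = {}"
proof -
  have *: "(fst v = 0, snd v) \<in> colouring A B \<longleftrightarrow> v \<in> stacked A {} B"
    if "v \<in> c - {v. fst v = 1}" for v
    using that assms by (cases v) (auto simp: mem_stacked)
  show "outer c \<subseteq> colouring A B \<longleftrightarrow> c - {v. fst v = 1} \<subseteq> stacked A {} B"
    unfolding outer_def image_subset_iff using * by blast
  show "outer c \<inter> colouring A B = {} \<longleftrightarrow> (c - {v. fst v = 1}) \<inter> stacked A {} B = {}"
    unfolding outer_def using * by blast
qed

text \<open>A component that reaches an outer row has its colour dictated by A and B, and these
  dictates are consistent exactly when (A, B) is saturated for the product. A component inside the
  middle row is coloured freely, which contributes a factor 2.\<close>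

lemma card_middles:
  assumes xy: "x \<in> setparts r" "y \<in> setparts r"
  shows "card (middles r x y A B) =
    (if saturated (fst (dcomp x y)) (colouring A B) then 2 ^ snd (dcomp x y) else 0)"
proof -
  define mid :: "(nat \<times> nat) set" where "mid = {v. fst v = 1}"
  define M where "M = {c \<in> comps x y. c \<subseteq> mid}"
  define N where "N = {c \<in> comps x y. \<not> c \<subseteq> mid}"
  note P = comps_partition[OF xy]
  have cover: "\<Union>(comps x y) = {0, 1, 2} \<times> {1..r}"
    using partition_onD1[OF P] by simp
  have disj: "c = d" if "c \<in> comps x y" "d \<in> comps x y" "v \<in> c" "v \<in> d" for c d v
    using partition_onD2[OF P] that by (auto dest: disjointD)
  have satN: "saturated (fst (dcomp x y)) (colouring A B) \<longleftrightarrow>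
      (\<forall>c\<in>N. c - mid \<subseteq> stacked A {} B \<or> (c - mid) \<inter> stacked A {} B = {})"
  proof -
    have "outer c \<subseteq> colouring A B \<longleftrightarrow> c - mid \<subseteq> stacked A {} B"
      "outer c \<inter> colouring A B = {} \<longleftrightarrow> (c - mid) \<inter> stacked A {} B = {}" if "c \<in> N" for c
    proof -
      have "c \<subseteq> {0, 1, 2} \<times> {1..r}"
        unfolding cover[symmetric] using that by (intro Union_upper) (simp add: N_def)
      from outer_colouring[OF this] show "outer c \<subseteq> colouring A B \<longleftrightarrow> c - mid \<subseteq> stacked A {} B"
        "outer c \<inter> colouring A B = {} \<longleftrightarrow> (c - mid) \<inter> stacked A {} B = {}"
        by (simp_all only: mid_def)
    qed
    then show ?thesis
      unfolding saturated_def fst_dcomp mid_def[symmetric] N_def[symmetric] ball_simps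
      by (intro ball_cong refl) (simp only:)
  qed
  have mids: "middles r x y A B = {m \<in> Pow {1..r}. saturated (comps x y) (stacked A m B)}"
    by (simp add: middles_def saturated_comps)
  have outm: "v \<in> stacked A m B \<longleftrightarrow> v \<in> stacked A {} B" if "v \<notin> mid" for v m
    using that by (cases v) (auto simp: mem_stacked mid_def)
  have inm: "v \<in> stacked A m B \<longleftrightarrow> snd v \<in> m" if "v \<in> mid" for v m
    using that by (cases v) (auto simp: mem_stacked mid_def)
  show ?thesis
  proof (cases "saturated (fst (dcomp x y)) (colouring A B)")
    case False
    have "middles r x y A B = {}"
    proof (rule ccontr)
      assume "middles r x y A B \<noteq> {}"
      then obtain m where m: "saturated (comps x y) (stacked A m B)"
        unfolding mids by auto
      have "\<forall>c\<in>N. c - mid \<subseteq> stacked A {} B \<or> (c - mid) \<inter> stacked A {} B = {}"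
      proof
        fix c assume "c \<in> N"
        then have "c \<subseteq> stacked A m B \<or> c \<inter> stacked A m B = {}"
          using m unfolding N_def saturated_def by auto
        then show "c - mid \<subseteq> stacked A {} B \<or> (c - mid) \<inter> stacked A {} B = {}"
          using outm by blast
      qed
      then show False using False satN by simp
    qed
    then show ?thesis using False by simp
  next
    case True
    define f where "f m = {c \<in> M. c \<subseteq> stacked A m B}" for m
    have "bij_betw f (middles r x y A B) (Pow M)"
      unfolding bij_betw_def
    proof
      have sub: "m \<subseteq> m'" if m: "m \<in> middles r x y A B" and m': "m' \<in> middles r x y A B"
        and eq: "f m = f m'" for m m'
      proof
        fix i assume i: "i \<in> m"
        then have "(1, i) \<in> \<Union>(comps x y)"
          using m unfolding cover mids by auto
        then obtain c where c: "c \<in> comps x y" "(1, i) \<in> c" by blast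
        have "(1, i) \<in> stacked A m B" using i by (simp add: mem_stacked)
        then have cm: "c \<subseteq> stacked A m B"
          using m c unfolding mids saturated_def by blast
        have "c \<subseteq> stacked A m' B"
        proof (cases "c \<subseteq> mid")
          case True
          then have "c \<in> f m" using c cm by (auto simp: f_def M_def)
          then show ?thesis unfolding eq by (simp add: f_def)
        next
          case False
          then obtain v where v: "v \<in> c" "v \<notin> mid" by auto
          then have "v \<in> stacked A m' B" using cm outm by blast
          then show ?thesis
            using v m' c unfolding mids saturated_def by blast
        qed
        then show "i \<in> m'" using c by (auto simp: mem_stacked)
      qed
      show "inj_on f (middles r x y A B)"
        by (rule inj_onI) (use sub in \<open>metis subset_antisym\<close>)
      show "f ` middles r x y A B = Pow M"
      proof (intro equalityI subsetI)
        fix Q assume Q: "Q \<in> Pow M"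
        \<comment> \<open>The inverse of \<open>f\<close>: colour the components chosen in Q
          together with those whose outer vertices are coloured by A and B, and let m be the middle
          part of their union.\<close>
        define T where "T = Q \<union> {c \<in> N. c - mid \<subseteq> stacked A {} B}"
        define m where "m = {i. (1, i) \<in> \<Union>T}"
        have TC: "T \<subseteq> comps x y" using Q by (auto simp: T_def M_def N_def)
        have key: "(c \<in> T \<longrightarrow> c \<subseteq> stacked A m B) \<and> (c \<notin> T \<longrightarrow> c \<inter> stacked A m B = {})"
          if c: "c \<in> comps x y" for c
        proof -
          have 1: "v \<in> stacked A m B \<longleftrightarrow> c \<in> T" if v: "v \<in> c" "v \<in> mid" for v
          proof -
            have "v = (1, snd v)" using v by (cases v) (auto simp: mid_def)
            then have "v \<in> stacked A m B \<longleftrightarrow> v \<in> \<Union>T"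
              using inm[OF v(2)] by (auto simp: m_def)
            also have "\<dots> \<longleftrightarrow> c \<in> T" using disj[OF c] TC v by blast
            finally show ?thesis .
          qed
          have 2: "v \<in> stacked A m B \<longleftrightarrow> c \<in> T" if v: "v \<in> c" "v \<notin> mid" for v
          proof -
            have cN: "c \<in> N" using c v by (auto simp: N_def)
            have "c \<notin> Q" using Q v by (auto simp: M_def)
            then have "c \<in> T \<longleftrightarrow> c - mid \<subseteq> stacked A {} B" using cN by (auto simp: T_def)
            also have "\<dots> \<longleftrightarrow> v \<in> stacked A {} B"
              using True cN v unfolding satN by blast
            finally show ?thesis using outm[OF v(2)] by simp
          qed
          show ?thesis using 1 2 by blast
        qed
        have "m \<subseteq> {1..r}"
        proof
          fix i assume "i \<in> m"
          then have "(1, i) \<in> \<Union>(comps x y)" using Union_mono[OF TC] by (auto simp: m_def)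
          then show "i \<in> {1..r}" unfolding cover by simp
        qed
        then have mm: "m \<in> middles r x y A B"
          unfolding mids saturated_def using key by auto
        have ne: "c \<noteq> {}" if "c \<in> M" for c
          using that partition_onD3[OF P] by (auto simp: M_def)
        have "f m = Q"
        proof (intro equalityI subsetI)
          fix c assume "c \<in> f m"
          then have "c \<in> M" "c \<subseteq> stacked A m B" by (auto simp: f_def)
          then have "c \<in> T" using key[of c] ne[of c] by (simp add: M_def) blast
          then show "c \<in> Q" using \<open>c \<in> M\<close> by (auto simp: T_def M_def N_def)
        next
          fix c assume "c \<in> Q"
          then show "c \<in> f m" using Q key[of c] by (auto simp: f_def M_def T_def)
        qed
        then show "Q \<in> f ` middles r x y A B" using mm by blast
      qed (auto simp: f_def)
    qed
    then have "card (middles r x y A B) = card (Pow M)" by (rule bij_betw_same_card)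
    moreover have "finite M"
    proof -
      have "finite (comps x y)"
        by (rule finite_elements[OF _ P]) auto
      then show ?thesis by (simp add: M_def)
    qed
    ultimately show ?thesis
      using True by (simp add: card_Pow snd_dcomp M_def mid_def)
  qed
qed

text \<open>Blocks are the minimal nonempty saturated sets, so the saturated sets determine the
  partition.\<close>

lemma setparts_eqI:
  assumes x: "x \<in> setparts r" and y: "y \<in> setparts r"
    and eq: "\<And>A B. A \<subseteq> {1..r} \<Longrightarrow> B \<subseteq> {1..r} \<Longrightarrow>
      saturated x (colouring A B) = saturated y (colouring A B)"
  shows "x = y"
proof -
  have sub: "x \<subseteq> y" if x: "x \<in> setparts r" and y: "y \<in> setparts r"
    and eq: "\<And>A B. A \<subseteq> {1..r} \<Longrightarrow> B \<subseteq> {1..r} \<Longrightarrow>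
      saturated x (colouring A B) = saturated y (colouring A B)" for x y
  proof
    have Px: "partition_on (verts r) x" and Py: "partition_on (verts r) y"
      using x y by (auto simp: setparts_def)
    have dx: "c = d" if "c \<in> x" "d \<in> x" "v \<in> c" "v \<in> d" for c d v
      using partition_onD2[OF Px] that by (auto dest: disjointD)
    have dy: "c = d" if "c \<in> y" "d \<in> y" "v \<in> c" "v \<in> d" for c d v
      using partition_onD2[OF Py] that by (auto dest: disjointD)
    have split: "\<exists>A B. A \<subseteq> {1..r} \<and> B \<subseteq> {1..r} \<and> b = colouring A B" if "b \<subseteq> verts r" for b
    proof (intro exI conjI)
      show "{i. (True, i) \<in> b} \<subseteq> {1..r}" "{i. (False, i) \<in> b} \<subseteq> {1..r}"
        using that by (auto simp: verts_def)
      show "b = colouring {i. (True, i) \<in> b} {i. (False, i) \<in> b}"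
      proof (rule set_eqI)
        fix v show "v \<in> b \<longleftrightarrow> v \<in> colouring {i. (True, i) \<in> b} {i. (False, i) \<in> b}"
          by (cases v; cases "fst v") auto
      qed
    qed
    fix b assume b: "b \<in> x"
    have bv: "b \<subseteq> verts r" and "b \<noteq> {}"
      using b partition_onD1[OF Px] partition_onD3[OF Px] by auto
    then obtain v where v: "v \<in> b" by auto
    then obtain c where c: "c \<in> y" "v \<in> c"
      using bv partition_onD1[OF Py] by auto
    have cv: "c \<subseteq> verts r" using c partition_onD1[OF Py] by auto
    \<comment> \<open>Each block is saturated for its own partition, hence by assumption for the
      other one; two blocks that share v then contain each other.\<close>
    have "saturated x b" unfolding saturated_def using dx b by blast
    then have "saturated y b" using split[OF bv] eq by metis
    then have "c \<subseteq> b" using c v unfolding saturated_def by blast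
    have "saturated y c" unfolding saturated_def using dy c by blast
    then have "saturated x c" using split[OF cv] eq by metis
    then have "b \<subseteq> c" using c v b unfolding saturated_def by blast
    then show "b \<in> y" using \<open>c \<subseteq> b\<close> c by auto
  qed
  show ?thesis
    using sub[OF x y eq] sub[OF y x eq[symmetric]] by blast
qed

lemma saturated_empty: "saturated x (colouring {} {})"
  by (simp add: saturated_def colouring_def)

text \<open>Counting the pairs of compatible 2-colourings of both middle rows of a triple stack,
  in either order, gives associativity of diagrams and of the number of deleted components.\<close>

lemma dcomp_assoc:
  assumes xyz: "x \<in> setparts r" "y \<in> setparts r" "z \<in> setparts r"
  shows "fst (dcomp (fst (dcomp x y)) z) = fst (dcomp x (fst (dcomp y z)))"
    and "snd (dcomp x y) + snd (dcomp (fst (dcomp x y)) z) =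
         snd (dcomp y z) + snd (dcomp x (fst (dcomp y z)))"
proof -
  let ?xy = "fst (dcomp x y)" and ?yz = "fst (dcomp y z)"
  let ?l = "fst (dcomp ?xy z)" and ?r = "fst (dcomp x ?yz)"
  have xy: "?xy \<in> setparts r" and yz: "?yz \<in> setparts r"
    using xyz by (auto intro: dcomp_setparts)
  have lr: "?l \<in> setparts r" "?r \<in> setparts r"
    using xyz xy yz by (auto intro: dcomp_setparts)
  have e: "2 ^ snd (dcomp x y) * (if saturated ?l (colouring A B) then 2 ^ snd (dcomp ?xy z) else 0) =
      2 ^ snd (dcomp y z) * (if saturated ?r (colouring A B) then 2 ^ snd (dcomp x ?yz) else (0::nat))" for A B
  proof -
    have card_of_bool: "card {m \<in> Pow {1..r}. Q m} = (\<Sum>m\<in>Pow {1..r}. of_bool (Q m))" for Q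
      by (simp add: sum.If_cases of_bool_def) (rule arg_cong[where f = card], auto)
    let ?c = "\<lambda>m m'. of_bool (saturated x (colouring A m) \<and> saturated y (colouring m m') \<and>
        saturated z (colouring m' B)) :: nat"
    have c1: "card (middles r x y A m') * of_bool (saturated z (colouring m' B)) =
       (\<Sum>m\<in>Pow {1..r}. ?c m m')" for m'
      by (cases "saturated z (colouring m' B)") (simp_all only: middles_def card_of_bool, simp_all)
    have c2: "card (middles r y z m B) * of_bool (saturated x (colouring A m)) =
       (\<Sum>m'\<in>Pow {1..r}. ?c m m')" for m
      by (cases "saturated x (colouring A m)") (simp_all only: middles_def card_of_bool, simp_all)
    have "2 ^ snd (dcomp x y) * (if saturated ?l (colouring A B) then 2 ^ snd (dcomp ?xy z) else 0) =
        2 ^ snd (dcomp x y) * card (middles r ?xy z A B)"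
      by (simp add: card_middles[OF xy xyz(3)])
    also have "\<dots> = 2 ^ snd (dcomp x y) * (\<Sum>m'\<in>Pow {1..r}. of_bool (saturated ?xy (colouring A m') \<and> saturated z (colouring m' B)))"
      by (simp only: middles_def card_of_bool)
    also have "\<dots> = (\<Sum>m'\<in>Pow {1..r}. card (middles r x y A m') * of_bool (saturated z (colouring m' B)))"
      unfolding sum_distrib_left
      by (rule sum.cong) (auto simp: card_middles[OF xyz(1,2)])
    also have "\<dots> = (\<Sum>m\<in>Pow {1..r}. card (middles r y z m B) * of_bool (saturated x (colouring A m)))"
      unfolding c1 c2 by (rule sum.swap)
    also have "\<dots> = 2 ^ snd (dcomp y z) * (\<Sum>m\<in>Pow {1..r}. of_bool (saturated x (colouring A m) \<and> saturated ?yz (colouring m B)))"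
      unfolding sum_distrib_left
      by (rule sum.cong) (auto simp: card_middles[OF xyz(2,3)])
    also have "\<dots> = 2 ^ snd (dcomp y z) * card (middles r x ?yz A B)"
      by (simp only: middles_def card_of_bool)
    finally show ?thesis by (simp add: card_middles[OF xyz(1) yz])
  qed
  show "?l = ?r"
  proof (rule setparts_eqI[OF lr])
    fix A B :: "nat set"
    from e[of A B] show "saturated ?l (colouring A B) = saturated ?r (colouring A B)"
      by (auto split: if_splits)
  qed
  \<comment> \<open>Empty colour sets are saturated for every diagram, so both indicators equal 1
    and only the powers of 2 remain to be compared.\<close>
  from e[of "{}" "{}"] show "snd (dcomp x y) + snd (dcomp ?xy z) = snd (dcomp y z) + snd (dcomp x ?yz)"
    using saturated_empty
    by (simp flip: power_add)
qed

section \<open>The product on coefficient functions\<close>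

lemma finite_setparts: "finite (setparts r)"
  unfolding setparts_def by (rule finitely_many_partition_on) (simp add: verts_def)

lemma pa_mult_assoc: "pa_mult n r (pa_mult n r f g) h = pa_mult n r f (pa_mult n r g h)"
proof
  fix d
  let ?S = "setparts r" and ?n = "of_int n :: rat"
  let ?T = "\<lambda>x y z. f x * g y * h z * ?n ^ (snd (dcomp x y) + snd (dcomp (fst (dcomp x y)) z)) *
      of_bool (fst (dcomp (fst (dcomp x y)) z) = d)"
  \<comment> \<open>Writing the condition \<open>fst (dcomp x y) = w\<close> as a factor lets the
    sum over intermediate diagrams w collapse. The surviving w must lie in
    \<open>setparts r\<close>, which \<open>dcomp_setparts\<close> supplies.\<close>
  have delta: "(\<Sum>w\<in>?S. of_bool (v = w) * F w) = F v" if "v \<in> ?S" for v and F :: "_ \<Rightarrow> rat"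
    using that finite_setparts[of r] by (simp add: of_bool_def if_distrib[where f = "\<lambda>x. x * _"] cong: if_cong)
  have rotate: "(\<Sum>w\<in>?S. \<Sum>x\<in>?S. \<Sum>y\<in>?S. G w x y) = (\<Sum>x\<in>?S. \<Sum>y\<in>?S. \<Sum>w\<in>?S. G w x y)"
    for G :: "_ \<Rightarrow> _ \<Rightarrow> _ \<Rightarrow> rat"
    by (subst sum.swap) (intro sum.cong refl sum.swap)
  have reorder: "(\<Sum>w\<in>?S. \<Sum>z\<in>?S. \<Sum>x\<in>?S. \<Sum>y\<in>?S. G w x y z) =
      (\<Sum>x\<in>?S. \<Sum>y\<in>?S. \<Sum>z\<in>?S. \<Sum>w\<in>?S. G w x y z)"
    for G :: "_ \<Rightarrow> _ \<Rightarrow> _ \<Rightarrow> _ \<Rightarrow> rat"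
  proof -
    have "(\<Sum>w\<in>?S. \<Sum>z\<in>?S. \<Sum>x\<in>?S. \<Sum>y\<in>?S. G w x y z) =
        (\<Sum>w\<in>?S. \<Sum>x\<in>?S. \<Sum>y\<in>?S. \<Sum>z\<in>?S. G w x y z)"
      by (intro sum.cong refl rotate)
    also have "\<dots> = (\<Sum>x\<in>?S. \<Sum>y\<in>?S. \<Sum>w\<in>?S. \<Sum>z\<in>?S. G w x y z)"
      by (rule rotate)
    also have "\<dots> = (\<Sum>x\<in>?S. \<Sum>y\<in>?S. \<Sum>z\<in>?S. \<Sum>w\<in>?S. G w x y z)"
      by (intro sum.cong refl sum.swap)
    finally show ?thesis .
  qed
  have "pa_mult n r (pa_mult n r f g) h d =
      (\<Sum>w\<in>?S. \<Sum>z\<in>?S. \<Sum>x\<in>?S. \<Sum>y\<in>?S. of_bool (fst (dcomp x y) = w) *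
        (f x * g y * h z * ?n ^ (snd (dcomp x y) + snd (dcomp w z)) * of_bool (fst (dcomp w z) = d)))"
    unfolding pa_mult_def
    by (intro sum.cong refl) (auto simp: sum_distrib_right sum_distrib_left power_add intro!: sum.cong)
  also have "\<dots> = (\<Sum>x\<in>?S. \<Sum>y\<in>?S. \<Sum>z\<in>?S. \<Sum>w\<in>?S. of_bool (fst (dcomp x y) = w) *
        (f x * g y * h z * ?n ^ (snd (dcomp x y) + snd (dcomp w z)) * of_bool (fst (dcomp w z) = d)))"
    by (rule reorder)
  also have "\<dots> = (\<Sum>x\<in>?S. \<Sum>y\<in>?S. \<Sum>z\<in>?S. ?T x y z)"
    by (intro sum.cong refl delta dcomp_setparts)
  also have "\<dots> = (\<Sum>x\<in>?S. \<Sum>y\<in>?S. \<Sum>z\<in>?S. \<Sum>w\<in>?S. of_bool (fst (dcomp y z) = w) *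
        (f x * g y * h z * ?n ^ (snd (dcomp y z) + snd (dcomp x w)) * of_bool (fst (dcomp x w) = d)))"
    by (intro sum.cong refl, subst delta) (auto simp: dcomp_assoc intro: dcomp_setparts)
  also have "\<dots> = (\<Sum>x\<in>?S. \<Sum>w\<in>?S. \<Sum>y\<in>?S. \<Sum>z\<in>?S. of_bool (fst (dcomp y z) = w) *
        (f x * g y * h z * ?n ^ (snd (dcomp y z) + snd (dcomp x w)) * of_bool (fst (dcomp x w) = d)))"
    by (intro sum.cong refl rotate[symmetric])
  also have "\<dots> = pa_mult n r f (pa_mult n r g h) d"
    unfolding pa_mult_def
    by (intro sum.cong refl) (auto simp: sum_distrib_right sum_distrib_left power_add intro!: sum.cong)
  finally show "pa_mult n r (pa_mult n r f g) h d = pa_mult n r f (pa_mult n r g h) d" .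
qed

lemma pa_mult_sum_left: "pa_mult n r (\<Sum>i\<in>I. f i) g = (\<Sum>i\<in>I. pa_mult n r (f i) g)"
proof (induction I rule: infinite_finite_induct)
  case (insert i I)
  have "pa_mult n r (f i + h) g = pa_mult n r (f i) g + pa_mult n r h g" for h
    unfolding pa_mult_def plus_fun_def sum.distrib[symmetric]
    by (intro ext sum.cong refl) (auto simp: algebra_simps)
  with insert show ?case by (simp del: plus_fun_apply)
qed (auto simp: pa_mult_def fun_eq_iff intro!: sum.neutral)

lemma pa_mult_sum_right: "pa_mult n r g (\<Sum>i\<in>I. f i) = (\<Sum>i\<in>I. pa_mult n r g (f i))"
proof (induction I rule: infinite_finite_induct)
  case (insert i I)
  have "pa_mult n r g (f i + h) = pa_mult n r g (f i) + pa_mult n r g h" for h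
    unfolding pa_mult_def plus_fun_def sum.distrib[symmetric]
    by (intro ext sum.cong refl) (auto simp: algebra_simps)
  with insert show ?case by (simp del: plus_fun_apply)
qed (auto simp: pa_mult_def fun_eq_iff intro!: sum.neutral)

lemma pa_mult_basis:
  assumes "x \<in> setparts r" "y \<in> setparts r" "dcomp x y = (z, 0)"
  shows "pa_mult n r (pa_basis x) (pa_basis y) = pa_basis z"
proof
  fix d
  have "pa_mult n r (pa_basis x) (pa_basis y) d = (\<Sum>x'\<in>setparts r. \<Sum>y'\<in>setparts r.
      if x' = x then (if y' = y then pa_basis z d else 0) else 0)"
    unfolding pa_mult_def
    by (intro sum.cong refl) (auto simp: pa_basis_def assms)
  also have "\<dots> = (\<Sum>x'\<in>setparts r. if x' = x then (\<Sum>y'\<in>setparts r. if y' = y then pa_basis z d else 0) else 0)"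
    by (intro sum.cong refl) auto
  also have "\<dots> = pa_basis z d"
    using assms finite_setparts[of r] by simp
  finally show "pa_mult n r (pa_basis x) (pa_basis y) d = pa_basis z d" .
qed

section \<open>Generators\<close>

definition represents :: "nat \<Rightarrow> (bool \<times> nat) set set \<Rightarrow> (nat set \<Rightarrow> nat set \<Rightarrow> bool) \<Rightarrow> bool" where
  "represents r d C \<longleftrightarrow> d \<in> setparts r \<and>
     (\<forall>A B. A \<subseteq> {1..r} \<longrightarrow> B \<subseteq> {1..r} \<longrightarrow> (saturated d (colouring A B) \<longleftrightarrow> C A B))"

definition representable :: "nat \<Rightarrow> (nat set \<Rightarrow> nat set \<Rightarrow> bool) \<Rightarrow> bool" where
  "representable r C \<longleftrightarrow> (\<exists>d. represents r d C)"

text \<open>The description denotes a known diagram only when \<open>C\<close> is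
  \<open>representable\<close>; this is why the product rules below also deliver representability of
  the result.\<close>

definition diag :: "nat \<Rightarrow> (nat set \<Rightarrow> nat set \<Rightarrow> bool) \<Rightarrow> pa" where
  "diag r C = pa_basis (THE d. represents r d C)"

lemma diag_eq_basis:
  assumes "represents r d C"
  shows "diag r C = pa_basis d"
proof -
  have "(THE d. represents r d C) = d"
  proof (rule the_equality)
    show "represents r d C" by (rule assms)
  next
    fix e assume "represents r e C"
    with assms show "e = d"
      by (intro setparts_eqI[of e r d]) (auto simp: represents_def)
  qed
  then show ?thesis by (simp add: diag_def)
qed

lemma diag_cong:
  assumes "\<And>A B. A \<subseteq> {1..r} \<Longrightarrow> B \<subseteq> {1..r} \<Longrightarrow> C A B \<longleftrightarrow> C' A B"
  shows "diag r C = diag r C'" and "representable r C \<longleftrightarrow> representable r C'"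
proof -
  have "represents r d C = represents r d C'" for d
    using assms by (auto simp: represents_def)
  then show "diag r C = diag r C'" and "representable r C \<longleftrightarrow> representable r C'"
    by (simp_all add: diag_def representable_def)
qed

text \<open>By \<open>card_middles\<close> the number of fitting middle sets is either 0 or a power
  of 2 that is the same for all A and B. If it never exceeds 1, that power is 1: no component is
  deleted, and the product is a single diagram with coefficient 1.\<close>

lemma diag_mult:
  assumes rep: "representable r C1" "representable r C2"
    and uniq: "\<And>A B m m'. A \<subseteq> {1..r} \<Longrightarrow> B \<subseteq> {1..r} \<Longrightarrow> m \<subseteq> {1..r} \<Longrightarrow> m' \<subseteq> {1..r} \<Longrightarrow>
      C1 A m \<Longrightarrow> C2 m B \<Longrightarrow> C1 A m' \<Longrightarrow> C2 m' B \<Longrightarrow> m = m'"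
    and C3: "\<And>A B. A \<subseteq> {1..r} \<Longrightarrow> B \<subseteq> {1..r} \<Longrightarrow> C3 A B \<longleftrightarrow> (\<exists>m\<subseteq>{1..r}. C1 A m \<and> C2 m B)"
  shows "pa_mult n r (diag r C1) (diag r C2) = diag r C3" and "representable r C3"
proof -
  obtain x y where x: "represents r x C1" and y: "represents r y C2"
    using rep by (auto simp: representable_def)
  then have xy: "x \<in> setparts r" "y \<in> setparts r" by (auto simp: represents_def)
  obtain z l where z: "dcomp x y = (z, l)" by (cases "dcomp x y")
  have zs: "z \<in> setparts r" using dcomp_setparts[OF xy] z by simp
  have mid: "middles r x y A B = {m \<in> Pow {1..r}. C1 A m \<and> C2 m B}"
    if "A \<subseteq> {1..r}" "B \<subseteq> {1..r}" for A B
    using x y that unfolding middles_def represents_def by auto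
  have cnt: "card (middles r x y A B) = (if C3 A B then 1 else 0)"
    if AB: "A \<subseteq> {1..r}" "B \<subseteq> {1..r}" for A B
  proof (cases "C3 A B")
    case True
    then obtain m where m: "m \<subseteq> {1..r}" "C1 A m" "C2 m B" using C3[OF AB] by auto
    then have "middles r x y A B = {m}"
      unfolding mid[OF AB] using uniq[OF AB] by auto
    then show ?thesis using True by simp
  next
    case False
    then have "middles r x y A B = {}" unfolding mid[OF AB] using C3[OF AB] by auto
    then show ?thesis using False by simp
  qed
  have e: "(if C3 A B then 1 else 0) = (if saturated z (colouring A B) then 2 ^ l else (0::nat))"
    if "A \<subseteq> {1..r}" "B \<subseteq> {1..r}" for A B
    using cnt[OF that] card_middles[OF xy, of A B] unfolding z fst_conv snd_conv by metis
  have "represents r z C3"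
    unfolding represents_def using zs e by (metis power_not_zero zero_neq_numeral zero_neq_one)
  moreover have "l = 0"
  proof -
    have "(2::nat) ^ l = 1"
      using e[of "{}" "{}"] saturated_empty by (metis empty_subsetI power_not_zero zero_neq_numeral)
    then show ?thesis by simp
  qed
  ultimately show "pa_mult n r (diag r C1) (diag r C2) = diag r C3" "representable r C3"
    using pa_mult_basis[OF xy] z x y by (auto simp: diag_eq_basis representable_def)
qed

section \<open>Colour relations of the generators\<close>

definition perm_col :: "nat \<Rightarrow> (nat \<Rightarrow> nat) \<Rightarrow> nat set \<Rightarrow> nat set \<Rightarrow> bool" where
  "perm_col r \<sigma> A m \<longleftrightarrow> (\<forall>i\<in>{1..r}. i \<in> A \<longleftrightarrow> \<sigma> i \<in> m)"

definition cut_col :: "nat \<Rightarrow> nat set \<Rightarrow> nat set \<Rightarrow> nat set \<Rightarrow> bool" where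
  "cut_col r I A m \<longleftrightarrow> (\<forall>i\<in>{1..r} - I. i \<in> A \<longleftrightarrow> i \<in> m)"

definition glue_col :: "nat set \<Rightarrow> nat set \<Rightarrow> nat set \<Rightarrow> bool" where
  "glue_col J A m \<longleftrightarrow> A = m \<and> (\<forall>i\<in>J. i \<in> A \<longleftrightarrow> Suc i \<in> A)"

lemma saturated_Un: "saturated (d \<union> e) S \<longleftrightarrow> saturated d S \<and> saturated e S"
  by (auto simp: saturated_def)

lemma saturated_insert: "saturated (insert b d) S \<longleftrightarrow> (b \<subseteq> S \<or> b \<inter> S = {}) \<and> saturated d S"
  by (simp add: saturated_def)

lemma saturated_lines:
  "saturated {{(True, i), (False, i)} | i. i \<in> I} (colouring A B) \<longleftrightarrow> (\<forall>i\<in>I. i \<in> A \<longleftrightarrow> i \<in> B)"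
proof -
  have "{{(True, i), (False, i)} | i. i \<in> I} = (\<lambda>i. {(True, i), (False, i)}) ` I" by auto
  then show ?thesis by (simp add: saturated_def) blast
qed

lemma represents_one: "represents r {{(True, i), (False, i)} | i. i \<in> {1..r}} (=)"
  unfolding represents_def setparts_def mem_Collect_eq
proof (intro conjI allI impI)
  show "partition_on (verts r) {{(True, i), (False, i)} | i. i \<in> {1..r}}"
    by (rule partition_onI) (auto simp: verts_def disjnt_def, metis (full_types) atLeastAtMost_iff insertCI)
next
  fix A B :: "nat set" assume "A \<subseteq> {1..r}" "B \<subseteq> {1..r}"
  then show "saturated {{(True, i), (False, i)} | i. i \<in> {1..r}} (colouring A B) \<longleftrightarrow> A = B"
    unfolding saturated_lines by auto
qed

lemma represents_s_adj:
  assumes "1 \<le> k" "Suc k \<le> r"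
  shows "represents r ({{(True, k), (False, Suc k)}, {(True, Suc k), (False, k)}}
      \<union> {{(True, i), (False, i)} | i. i \<in> {1..r} - {k, Suc k}}) (perm_col r (transpose k (Suc k)))"
    (is "represents r ?d _")
  unfolding represents_def setparts_def mem_Collect_eq
proof (intro conjI allI impI)
  show "partition_on (verts r) ?d"
  proof (rule partition_onI)
    show "\<Union> ?d = verts r"
    proof (intro equalityI subsetI)
      fix v assume v: "v \<in> verts r"
      obtain b i where [simp]: "v = (b, i)" by (cases v)
      show "v \<in> \<Union> ?d"
        using v by (cases b; cases "i = k \<or> i = Suc k") (auto simp: verts_def)
    qed (use assms in \<open>auto simp: verts_def\<close>)
  qed (auto simp: disjnt_def)
next
  fix A B :: "nat set" assume "A \<subseteq> {1..r}" "B \<subseteq> {1..r}"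
  have "saturated ?d (colouring A B) \<longleftrightarrow> (k \<in> A \<longleftrightarrow> Suc k \<in> B) \<and> (Suc k \<in> A \<longleftrightarrow> k \<in> B) \<and>
      (\<forall>i\<in>{1..r} - {k, Suc k}. i \<in> A \<longleftrightarrow> i \<in> B)"
    unfolding saturated_Un saturated_insert saturated_lines by (auto simp: saturated_def)
  also have "\<dots> \<longleftrightarrow> perm_col r (transpose k (Suc k)) A B"
  proof -
    define R where "R = {1..r} - {k, Suc k}"
    have split: "{1..r} = insert k (insert (Suc k) R)" using assms by (auto simp: R_def)
    have "(\<forall>i\<in>R. i \<in> A \<longleftrightarrow> transpose k (Suc k) i \<in> B) \<longleftrightarrow> (\<forall>i\<in>R. i \<in> A \<longleftrightarrow> i \<in> B)"
      by (rule ball_cong) (auto simp: R_def)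
    then show ?thesis
      unfolding perm_col_def R_def[symmetric] unfolding split by simp
  qed
  finally show "saturated ?d (colouring A B) \<longleftrightarrow> perm_col r (transpose k (Suc k)) A B" .
qed

lemma represents_p_int:
  assumes "1 \<le> k" "k \<le> r"
  shows "represents r ({{(True, k)}, {(False, k)}}
      \<union> {{(True, i), (False, i)} | i. i \<in> {1..r} - {k}}) (cut_col r {k})"
    (is "represents r ?d _")
  unfolding represents_def setparts_def mem_Collect_eq
proof (intro conjI allI impI)
  show "partition_on (verts r) ?d"
  proof (rule partition_onI)
    show "\<Union> ?d = verts r"
    proof (intro equalityI subsetI)
      fix v assume v: "v \<in> verts r"
      obtain b i where [simp]: "v = (b, i)" by (cases v)
      show "v \<in> \<Union> ?d"
        using v by (cases b; cases "i = k") (auto simp: verts_def)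
    qed (use assms in \<open>auto simp: verts_def\<close>)
  qed (auto simp: disjnt_def)
next
  fix A B :: "nat set" assume "A \<subseteq> {1..r}" "B \<subseteq> {1..r}"
  show "saturated ?d (colouring A B) \<longleftrightarrow> cut_col r {k} A B"
    unfolding saturated_Un saturated_insert saturated_lines cut_col_def by (auto simp: saturated_def)
qed

lemma represents_p_half:
  assumes "1 \<le> k" "Suc k \<le> r"
  shows "represents r ({{(True, k), (True, Suc k), (False, k), (False, Suc k)}}
      \<union> {{(True, i), (False, i)} | i. i \<in> {1..r} - {k, Suc k}}) (glue_col {k})"
    (is "represents r ?d _")
  unfolding represents_def setparts_def mem_Collect_eq
proof (intro conjI allI impI)
  show "partition_on (verts r) ?d"
  proof (rule partition_onI)
    show "\<Union> ?d = verts r"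
    proof (intro equalityI subsetI)
      fix v assume v: "v \<in> verts r"
      obtain b i where [simp]: "v = (b, i)" by (cases v)
      show "v \<in> \<Union> ?d"
        using v by (cases b; cases "i = k \<or> i = Suc k") (auto simp: verts_def)
    qed (use assms in \<open>auto simp: verts_def\<close>)
  qed (auto simp: disjnt_def)
next
  fix A B :: "nat set" assume AB: "A \<subseteq> {1..r}" "B \<subseteq> {1..r}"
  have "saturated ?d (colouring A B) \<longleftrightarrow> (k \<in> A \<longleftrightarrow> Suc k \<in> A) \<and> (k \<in> A \<longleftrightarrow> k \<in> B) \<and>
      (k \<in> A \<longleftrightarrow> Suc k \<in> B) \<and> (\<forall>i\<in>{1..r} - {k, Suc k}. i \<in> A \<longleftrightarrow> i \<in> B)"
    unfolding saturated_Un saturated_insert saturated_lines by (auto simp: saturated_def)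
  also have "\<dots> \<longleftrightarrow> (k \<in> A \<longleftrightarrow> Suc k \<in> A) \<and> (\<forall>i\<in>{1..r}. i \<in> A \<longleftrightarrow> i \<in> B)"
  proof -
    define R where "R = {1..r} - {k, Suc k}"
    have split: "{1..r} = insert k (insert (Suc k) R)" using assms by (auto simp: R_def)
    show ?thesis
      unfolding R_def[symmetric] unfolding split by auto
  qed
  also have "\<dots> \<longleftrightarrow> glue_col {k} A B"
  proof -
    have "(\<forall>i\<in>{1..r}. i \<in> A \<longleftrightarrow> i \<in> B) \<longleftrightarrow> A = B" using AB by blast
    then show ?thesis by (auto simp: glue_col_def)
  qed
  finally show "saturated ?d (colouring A B) \<longleftrightarrow> glue_col {k} A B" .
qed

lemma pa_one_diag: "pa_one r = diag r (=)" "representable r (=)"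
  using represents_one[of r] by (auto simp: pa_one_def diag_eq_basis representable_def)

lemma s_adj_diag:
  assumes "1 \<le> k" "Suc k \<le> r"
  shows "s_adj r k = diag r (perm_col r (transpose k (Suc k)))"
    "representable r (perm_col r (transpose k (Suc k)))"
  using represents_s_adj[OF assms] by (auto simp: s_adj_def diag_eq_basis representable_def)

lemma p_int_diag:
  assumes "1 \<le> k" "k \<le> r"
  shows "p_int r k = diag r (cut_col r {k})" "representable r (cut_col r {k})"
  using represents_p_int[OF assms] by (auto simp: p_int_def diag_eq_basis representable_def)

lemma p_half_diag:
  assumes "1 \<le> k" "Suc k \<le> r"
  shows "p_half r k = diag r (glue_col {k})" "representable r (glue_col {k})"
  using represents_p_half[OF assms] by (auto simp: p_half_def diag_eq_basis representable_def)

lemma pa_mult_one_left: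
  assumes "representable r C"
  shows "pa_mult n r (pa_one r) (diag r C) = diag r C"
  unfolding pa_one_diag by (rule diag_mult(1)[OF pa_one_diag(2) assms]) auto

text \<open>Cutting leaves the middle vertices in I free from above, so they must be pinned from
  below: \<open>f\<close> says how the southern set B decides them. A northern vertex in I isolated
  in C would instead become a deleted component and contribute a factor n.\<close>

lemma cut_mult:
  assumes "representable r (cut_col r I)" "representable r C"
    and forced: "\<And>A B i. A \<subseteq> {1..r} \<Longrightarrow> B \<subseteq> {1..r} \<Longrightarrow> C A B \<Longrightarrow> i \<in> I \<Longrightarrow> (i \<in> A \<longleftrightarrow> f B i)"
    and C': "\<And>A B. A \<subseteq> {1..r} \<Longrightarrow> B \<subseteq> {1..r} \<Longrightarrow>
      C' A B \<longleftrightarrow> C ((A - I) \<union> {i \<in> I. f B i}) B"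
    and I: "I \<subseteq> {1..r}"
  shows "pa_mult n r (diag r (cut_col r I)) (diag r C) = diag r C'" "representable r C'"
proof -
  have eq: "m = (A - I) \<union> {i \<in> I. f B i}" if "A \<subseteq> {1..r}" "B \<subseteq> {1..r}" "m \<subseteq> {1..r}"
    "cut_col r I A m" "C m B" for A B m
    using that forced[OF that(3,2,5)] unfolding cut_col_def by blast
  have C3: "C' A B \<longleftrightarrow> (\<exists>m\<subseteq>{1..r}. cut_col r I A m \<and> C m B)"
    if AB: "A \<subseteq> {1..r}" "B \<subseteq> {1..r}" for A B
  proof
    assume "C' A B"
    then show "\<exists>m\<subseteq>{1..r}. cut_col r I A m \<and> C m B"
      using AB I by (intro exI[of _ "(A - I) \<union> {i \<in> I. f B i}"]) (auto simp: C' cut_col_def)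
  next
    assume "\<exists>m\<subseteq>{1..r}. cut_col r I A m \<and> C m B"
    then obtain m where m: "m \<subseteq> {1..r}" "cut_col r I A m" "C m B" by blast
    show "C' A B" using m(3) unfolding C'[OF AB] eq[OF AB m] .
  qed
  have uniq: "m = m'" if "A \<subseteq> {1..r}" "B \<subseteq> {1..r}" "m \<subseteq> {1..r}" "m' \<subseteq> {1..r}"
      "cut_col r I A m" "C m B" "cut_col r I A m'" "C m' B" for A B m m'
    using eq[OF that(1,2,3,5,6)] eq[OF that(1,2,4,7,8)] by simp
  show "pa_mult n r (diag r (cut_col r I)) (diag r C) = diag r C'"
    by (rule diag_mult(1)[OF assms(1,2) uniq C3])
  show "representable r C'"
    by (rule diag_mult(2)[OF assms(1,2) uniq C3])
qed

text \<open>Distinctness is essential, since p_i p_i = n p_i. At a new index i the remaining product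
  is the identity, so the colour of the middle vertex i is read off from B.\<close>

lemma prod_p_int:
  assumes "distinct is" "set is \<subseteq> {1..r}"
  shows "pa_prod n r (map (p_int r) is) = diag r (cut_col r (set is)) \<and> representable r (cut_col r (set is))"
  using assms
proof (induction "is")
  case Nil
  have "A = B \<longleftrightarrow> cut_col r {} A B" if "A \<subseteq> {1..r}" "B \<subseteq> {1..r}" for A B
    using that by (auto simp: cut_col_def)
  note diag_cong[of r "(=)" "cut_col r {}", OF this]
  then show ?case using pa_one_diag[of r] by (simp add: pa_prod_def)
next
  case (Cons i "is")
  then have i: "1 \<le> i" "i \<le> r" "i \<notin> set is" by auto
  have forced: "j \<in> A \<longleftrightarrow> j \<in> B" if "cut_col r (set is) A B" "j \<in> {i}" for A B j
    using that i by (auto simp: cut_col_def)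
  have e: "cut_col r (set (i # is)) A B \<longleftrightarrow> cut_col r (set is) ((A - {i}) \<union> {j \<in> {i}. j \<in> B}) B" for A B
    using i unfolding cut_col_def by auto
  have "pa_mult n r (p_int r i) (diag r (cut_col r (set is))) = diag r (cut_col r (set (i # is)))"
    "representable r (cut_col r (set (i # is)))"
    unfolding p_int_diag(1)[OF i(1,2)]
    by (rule cut_mult[where f = "\<lambda>B j. j \<in> B" and I = "{i}" and C = "cut_col r (set is)"];
        use i Cons e forced p_int_diag(2)[OF i(1,2)] in simp)+
  then show ?case using Cons by (simp add: pa_prod_def)
qed

lemma e_int_diag:
  assumes "l \<le> k" "k \<le> r"
  shows "e_int n r l k = diag r (cut_col r {k - l<..k})" "representable r (cut_col r {k - l<..k})"
proof -
  have "set [Suc k - l..<Suc k] = {k - l<..k}" using assms by auto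
  moreover have "set [Suc k - l..<Suc k] \<subseteq> {1..r}" using assms by auto
  ultimately have *: "pa_prod n r (map (p_int r) [Suc k - l..<Suc k]) = diag r (cut_col r {k - l<..k}) \<and>
      representable r (cut_col r {k - l<..k})"
    using prod_p_int[of "[Suc k - l..<Suc k]" r n] by (metis distinct_upt)
  then show "representable r (cut_col r {k - l<..k})" by simp
  show "e_int n r l k = diag r (cut_col r {k - l<..k})"
  proof (cases "l = 0 \<or> k = 0")
    \<comment> \<open>The convention that \<open>e_int\<close> is 1 agrees with the product here:
      for k = 0 the bound l <= k forces l = 0, and then the list of factors is empty.\<close>
    case True
    then have "pa_prod n r (map (p_int r) [Suc k - l..<Suc k]) = pa_one r"
      using assms by (auto simp: pa_prod_def)
    with True * show ?thesis by (simp add: e_int_def)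
  qed (use * in \<open>auto simp: e_int_def\<close>)
qed

text \<open>Gluing is the identity on colours with added constraints, so the middle set has to be
  A.\<close>

lemma glue_mult:
  assumes "representable r (glue_col J)" "representable r C"
  shows "pa_mult n r (diag r (glue_col J)) (diag r C) =
      diag r (\<lambda>A B. (\<forall>i\<in>J. i \<in> A \<longleftrightarrow> Suc i \<in> A) \<and> C A B)"
    "representable r (\<lambda>A B. (\<forall>i\<in>J. i \<in> A \<longleftrightarrow> Suc i \<in> A) \<and> C A B)"
  by (rule diag_mult[OF assms]; auto simp: glue_col_def)+

lemma prod_p_half:
  assumes "set is \<subseteq> {1..<r}"
  shows "pa_prod n r (map (p_half r) is) = diag r (glue_col (set is)) \<and> representable r (glue_col (set is))"
  using assms
proof (induction "is")
  case Nil
  have "(=) = glue_col {}" by (auto simp: glue_col_def fun_eq_iff)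
  then show ?case using pa_one_diag[of r] by (simp add: pa_prod_def)
next
  case (Cons i "is")
  then have i: "1 \<le> i" "Suc i \<le> r" by auto
  have e: "(\<lambda>A B. (\<forall>i\<in>{i}. i \<in> A \<longleftrightarrow> Suc i \<in> A) \<and> glue_col (set is) A B) = glue_col (set (i # is))"
    unfolding glue_col_def by (intro ext) auto
  show ?case
    using glue_mult(1)[OF p_half_diag(2)[OF i], where C = "glue_col (set is)" and n = n]
      glue_mult(2)[OF p_half_diag(2)[OF i], where C = "glue_col (set is)"] Cons
    unfolding e p_half_diag(1)[OF i, symmetric] by (simp add: pa_prod_def)
qed

lemma e_half_diag:
  assumes "l \<le> k" "k < r"
  shows "e_half n r l k = diag r (glue_col {k - l<..k})" "representable r (glue_col {k - l<..k})"
proof -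
  have "set [Suc k - l..<Suc k] = {k - l<..k}" using assms by auto
  moreover have "set [Suc k - l..<Suc k] \<subseteq> {1..<r}" using assms by auto
  ultimately have *: "pa_prod n r (map (p_half r) [Suc k - l..<Suc k]) = diag r (glue_col {k - l<..k}) \<and>
      representable r (glue_col {k - l<..k})"
    using prod_p_half[of "[Suc k - l..<Suc k]" r n] by metis
  then show "representable r (glue_col {k - l<..k})" by simp
  show "e_half n r l k = diag r (glue_col {k - l<..k})"
    using * by (cases "l = 0") (auto simp: e_half_def pa_prod_def)
qed

lemma perm_mult:
  assumes "representable r (perm_col r \<sigma>)" "representable r C" "bij_betw \<sigma> {1..r} {1..r}"
  shows "pa_mult n r (diag r (perm_col r \<sigma>)) (diag r C) = diag r (\<lambda>A B. C (\<sigma> ` A) B)"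
    "representable r (\<lambda>A B. C (\<sigma> ` A) B)"
proof -
  have eq: "perm_col r \<sigma> A m \<longleftrightarrow> m = \<sigma> ` A" if "A \<subseteq> {1..r}" "m \<subseteq> {1..r}" for A m
  proof
    assume p: "perm_col r \<sigma> A m"
    show "m = \<sigma> ` A"
    proof (intro equalityI subsetI)
      fix j assume j: "j \<in> m"
      then have "j \<in> \<sigma> ` {1..r}" using that assms(3) by (auto simp: bij_betw_def)
      then obtain i where "i \<in> {1..r}" "j = \<sigma> i" by blast
      with p j show "j \<in> \<sigma> ` A" by (auto simp: perm_col_def)
    qed (use p that in \<open>auto simp: perm_col_def\<close>)
  next
    assume m: "m = \<sigma> ` A"
    show "perm_col r \<sigma> A m"
      unfolding perm_col_def
    proof
      fix i assume i: "i \<in> {1..r}"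
      show "i \<in> A \<longleftrightarrow> \<sigma> i \<in> m"
        unfolding m using inj_on_image_mem_iff[OF bij_betw_imp_inj_on[OF assms(3)] i that(1)] by simp
    qed
  qed
  have sub: "\<sigma> ` A \<subseteq> {1..r}" if "A \<subseteq> {1..r}" for A
    using that assms(3) by (auto simp: bij_betw_def)
  have C3: "C (\<sigma> ` A) B \<longleftrightarrow> (\<exists>m\<subseteq>{1..r}. perm_col r \<sigma> A m \<and> C m B)" if "A \<subseteq> {1..r}" for A B
    using eq[OF that] sub[OF that] by blast
  show "pa_mult n r (diag r (perm_col r \<sigma>)) (diag r C) = diag r (\<lambda>A B. C (\<sigma> ` A) B)"
    "representable r (\<lambda>A B. C (\<sigma> ` A) B)"
    by (rule diag_mult[OF assms(1,2) _ C3]; use eq in auto)+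
qed

lemma perm_col_image:
  assumes "bij_betw \<sigma> {1..r} {1..r}" "A \<subseteq> {1..r}"
  shows "perm_col r \<tau> (\<sigma> ` A) B \<longleftrightarrow> perm_col r (\<tau> \<circ> \<sigma>) A B"
proof -
  have "perm_col r \<tau> (\<sigma> ` A) B \<longleftrightarrow> (\<forall>j\<in>\<sigma> ` {1..r}. j \<in> \<sigma> ` A \<longleftrightarrow> \<tau> j \<in> B)"
    using assms(1) by (simp add: perm_col_def bij_betw_def)
  also have "\<dots> \<longleftrightarrow> (\<forall>i\<in>{1..r}. i \<in> A \<longleftrightarrow> \<tau> (\<sigma> i) \<in> B)"
    using inj_on_image_mem_iff[OF bij_betw_imp_inj_on[OF assms(1)] _ assms(2)] by simp
  finally show ?thesis by (simp add: perm_col_def)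
qed

text \<open>A strand followed from the north meets the upper factor first, whence the order of
  composition.\<close>

lemma perm_perm_mult:
  assumes "representable r (perm_col r \<sigma>)" "representable r (perm_col r \<tau>)" "bij_betw \<sigma> {1..r} {1..r}"
  shows "pa_mult n r (diag r (perm_col r \<sigma>)) (diag r (perm_col r \<tau>)) = diag r (perm_col r (\<tau> \<circ> \<sigma>))"
    "representable r (perm_col r (\<tau> \<circ> \<sigma>))"
  using perm_mult[OF assms(1,2,3)] diag_cong[of r "\<lambda>A B. perm_col r \<tau> (\<sigma> ` A) B" "perm_col r (\<tau> \<circ> \<sigma>)"]
    perm_col_image[OF assms(3)] by auto

section \<open>Cycles as products of adjacent transpositions\<close>

definition cyc :: "nat \<Rightarrow> nat \<Rightarrow> nat \<Rightarrow> nat" where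
  "cyc l k i = (if i = l then k else if l < i \<and> i \<le> k then i - 1 else if k \<le> i \<and> i < l then Suc i else i)"

lemma cyc_cyc: "cyc k l (cyc l k i) = i"
  unfolding cyc_def by auto

lemma bij_cyc:
  assumes "l \<in> {1..r}" "k \<in> {1..r}"
  shows "bij_betw (cyc l k) {1..r} {1..r}"
proof (rule bij_betw_byWitness[where f' = "cyc k l"])
  show "cyc l k ` {1..r} \<subseteq> {1..r}" "cyc k l ` {1..r} \<subseteq> {1..r}"
    using assms by (auto simp: cyc_def)
qed (auto simp: cyc_cyc)

lemma bij_transpose:
  assumes "1 \<le> k" "Suc k \<le> r"
  shows "bij_betw (transpose k (Suc k)) {1..r} {1..r}"
  using assms by (intro bij_betw_byWitness[where f' = "transpose k (Suc k)"]) (auto simp: transpose_def)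

lemma perm_col_id: "A \<subseteq> {1..r} \<Longrightarrow> B \<subseteq> {1..r} \<Longrightarrow> A = B \<longleftrightarrow> perm_col r (cyc k k) A B"
  by (auto simp: perm_col_def cyc_def)

text \<open>\<open>cyc l k\<close> carries northern l to southern k and shifts the vertices between
  them by one towards l. The ascending product gains its leftmost factor when l decreases, the
  descending one when l increases; both inductions therefore compose with a transposition that is
  applied first.\<close>

lemma s_gen_diag:
  assumes "l \<in> {1..r}" "k \<in> {1..r}"
  shows "s_gen n r l k = diag r (perm_col r (cyc l k)) \<and> representable r (perm_col r (cyc l k))"
proof -
  have one: "pa_one r = diag r (perm_col r (cyc k k)) \<and> representable r (perm_col r (cyc k k))" for k
    using pa_one_diag[of r] diag_cong[of r "(=)" "perm_col r (cyc k k)", OF perm_col_id] by auto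
  have up: "pa_prod n r (map (s_adj r) [l..<k]) = diag r (perm_col r (cyc l k)) \<and> representable r (perm_col r (cyc l k))"
    if "l \<le> k" "1 \<le> l" "k \<le> r" for l
    using that
  proof (induction rule: inc_induct)
    case base
    show ?case using one by (simp add: pa_prod_def)
  next
    case (step l)
    have "cyc (Suc l) k \<circ> transpose l (Suc l) = cyc l k"
      using step by (auto simp: fun_eq_iff cyc_def transpose_def)
    then show ?case
      using perm_perm_mult(1)[OF s_adj_diag(2)[of l r] _ bij_transpose[of l r], where \<tau> = "cyc (Suc l) k" and n = n]
        perm_perm_mult(2)[OF s_adj_diag(2)[of l r] _ bij_transpose[of l r], where \<tau> = "cyc (Suc l) k"] step
      by (simp add: upt_conv_Cons pa_prod_def s_adj_diag)
  qed
  have down: "pa_prod n r (rev (map (s_adj r) [k..<l])) = diag r (perm_col r (cyc l k)) \<and> representable r (perm_col r (cyc l k))"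
    if "k \<le> l" "1 \<le> k" "l \<le> r" for l
    using that
  proof (induction rule: dec_induct)
    case base
    show ?case using one by (simp add: pa_prod_def)
  next
    case (step l)
    have "cyc l k \<circ> transpose l (Suc l) = cyc (Suc l) k"
      using step by (auto simp: fun_eq_iff cyc_def transpose_def)
    then show ?case
      using perm_perm_mult(1)[OF s_adj_diag(2)[of l r] _ bij_transpose[of l r], where \<tau> = "cyc l k" and n = n]
        perm_perm_mult(2)[OF s_adj_diag(2)[of l r] _ bij_transpose[of l r], where \<tau> = "cyc l k"] step
      by (simp add: pa_prod_def s_adj_diag)
  qed
  show ?thesis
    using up[of l] down[of l] assms by (auto simp: s_gen_def)
qed

section \<open>Diagrams with predecessor links\<close>

text \<open>A pair (xs, p) encodes a diagram on the first k strands: the northern vertex q is joined to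
  the southern vertex xs ! (q - 1), the southern vertex i is joined to its predecessor p i in its
  block (p i = 0 if there is none), northern vertices beyond the length of xs up to k are isolated
  in a state and joined to the southern vertex k in a half state.\<close>

definition links_col :: "nat \<Rightarrow> nat list \<Rightarrow> (nat \<Rightarrow> nat) \<Rightarrow> nat \<Rightarrow> nat set \<Rightarrow> nat set \<Rightarrow> bool" where
  "links_col r xs p k A B \<longleftrightarrow> (\<forall>q<length xs. Suc q \<in> A \<longleftrightarrow> xs ! q \<in> B) \<and>
     (\<forall>q\<in>{k<..r}. q \<in> A \<longleftrightarrow> q \<in> B) \<and> (\<forall>i\<in>{1..r}. p i \<noteq> 0 \<longrightarrow> (i \<in> B \<longleftrightarrow> p i \<in> B))"

definition half_col :: "nat \<Rightarrow> nat list \<Rightarrow> (nat \<Rightarrow> nat) \<Rightarrow> nat \<Rightarrow> nat set \<Rightarrow> nat set \<Rightarrow> bool" where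
  "half_col r xs p k A B \<longleftrightarrow> links_col r xs p k A B \<and> (\<forall>q\<in>{length xs<..k}. q \<in> A \<longleftrightarrow> k \<in> B)"

section \<open>Link diagrams under permutation, gluing and cutting\<close>

definition ins :: "nat \<Rightarrow> 'a \<Rightarrow> 'a list \<Rightarrow> 'a list" where
  "ins j x xs = take j xs @ x # drop j xs"

text \<open>Places in \<open>ins\<close> and \<open>del\<close> count from 0, while northern
  vertices and prefix sums count from 1; hence each \<open>P - 1\<close> below.\<close>

definition del :: "nat \<Rightarrow> 'a list \<Rightarrow> 'a list" where
  "del j xs = take j xs @ drop (Suc j) xs"

lemma length_ins [simp]: "length (ins j x xs) = Suc (length xs)"
  by (simp add: ins_def)

lemma length_del [simp]: "j < length xs \<Longrightarrow> length (del j xs) = length xs - 1"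
  by (simp add: del_def)

text \<open>This is the effect of the permutation in a downward step: the entry at place m is
  brought to the last place, where gluing can reach it.\<close>

lemma nth_del_snoc:
  assumes "1 \<le> m" "m \<le> length xs" "q < length xs"
  shows "(del (m - 1) xs @ [xs ! (m - 1)]) ! q = xs ! (cyc (length xs) m (Suc q) - 1)"
  using assms by (auto simp: del_def cyc_def nth_append min_def)

text \<open>This is the effect of the permutations in an upward step: the newest entry moves from
  the last place to place l.\<close>

lemma nth_ins:
  assumes "1 \<le> l" "l \<le> Suc (length zs)" "q \<le> length zs"
  shows "ins (l - 1) x zs ! q = (zs @ [x]) ! (cyc l (Suc (length zs)) (Suc q) - 1)"
  using assms by (auto simp: ins_def cyc_def nth_append nth_Cons' min_def)

lemma all_less_iff: "(\<forall>q<n. Q (Suc q)) \<longleftrightarrow> (\<forall>i\<in>{1..n}. Q i)"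
  by (metis Suc_le_eq atLeastAtMost_iff le_add1 not0_implies_Suc not_one_le_zero plus_1_eq_Suc)

text \<open>Reindexing the listed northern vertices along the cycle turns the image of A back into A
  and permutes the word. Later northern vertices are fixed, because both ends of the cycle lie
  within the word.\<close>

lemma links_col_cyc:
  assumes "l \<in> {1..length xs}" "m \<in> {1..length xs}" "length xs \<le> k" "A \<subseteq> {1..r}"
    and "length ys = length xs" and ys: "\<And>q. q < length xs \<Longrightarrow> ys ! q = xs ! (cyc l m (Suc q) - 1)"
  shows "links_col r xs p k (cyc l m ` A) B \<longleftrightarrow> links_col r ys p k A B"
proof -
  have mem: "i \<in> cyc l m ` A \<longleftrightarrow> cyc m l i \<in> A" for i
    by (metis cyc_cyc image_iff)
  have "(\<forall>q<length xs. Suc q \<in> cyc l m ` A \<longleftrightarrow> xs ! q \<in> B) \<longleftrightarrow> (\<forall>i\<in>{1..length xs}. i \<in> cyc l m ` A \<longleftrightarrow> xs ! (i - 1) \<in> B)"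
    using all_less_iff[of "length xs" "\<lambda>i. i \<in> cyc l m ` A \<longleftrightarrow> xs ! (i - 1) \<in> B"] by simp
  also have "\<dots> \<longleftrightarrow> (\<forall>i\<in>cyc l m ` {1..length xs}. i \<in> cyc l m ` A \<longleftrightarrow> xs ! (i - 1) \<in> B)"
    using bij_cyc[OF assms(1,2)] by (simp add: bij_betw_def)
  also have "\<dots> \<longleftrightarrow> (\<forall>i\<in>{1..length xs}. i \<in> A \<longleftrightarrow> xs ! (cyc l m i - 1) \<in> B)"
    by (simp add: mem cyc_cyc)
  also have "\<dots> \<longleftrightarrow> (\<forall>q<length xs. Suc q \<in> A \<longleftrightarrow> xs ! (cyc l m (Suc q) - 1) \<in> B)"
    using all_less_iff[of "length xs" "\<lambda>i. i \<in> A \<longleftrightarrow> xs ! (cyc l m i - 1) \<in> B"] by simp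
  also have "\<dots> \<longleftrightarrow> (\<forall>q<length ys. Suc q \<in> A \<longleftrightarrow> ys ! q \<in> B)"
    using assms(5) ys by simp
  finally have 1: "(\<forall>q<length xs. Suc q \<in> cyc l m ` A \<longleftrightarrow> xs ! q \<in> B) \<longleftrightarrow> (\<forall>q<length ys. Suc q \<in> A \<longleftrightarrow> ys ! q \<in> B)" .
  have 2: "q \<in> cyc l m ` A \<longleftrightarrow> q \<in> A" if "q > length xs" for q
  proof -
    have "cyc m l q = q" using that assms by (auto simp: cyc_def)
    then show ?thesis by (simp add: mem)
  qed
  have 3: "(\<forall>q\<in>{k<..r}. q \<in> cyc l m ` A \<longleftrightarrow> q \<in> B) \<longleftrightarrow> (\<forall>q\<in>{k<..r}. q \<in> A \<longleftrightarrow> q \<in> B)"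
    using 2 assms(3) by auto
  show ?thesis
    unfolding links_col_def 1 3 ..
qed

lemma half_col_cyc:
  assumes "l \<in> {1..length xs}" "m \<in> {1..length xs}" "length xs \<le> k" "A \<subseteq> {1..r}"
    and "length ys = length xs" and ys: "\<And>q. q < length xs \<Longrightarrow> ys ! q = xs ! (cyc l m (Suc q) - 1)"
  shows "half_col r xs p k (cyc l m ` A) B \<longleftrightarrow> half_col r ys p k A B"
proof -
  have "q \<in> cyc l m ` A \<longleftrightarrow> q \<in> A" if "q > length xs" for q
  proof -
    have "cyc m l q = q" using that assms by (auto simp: cyc_def)
    then show ?thesis by (metis cyc_cyc image_iff)
  qed
  then have "(\<forall>q\<in>{length xs<..k}. q \<in> cyc l m ` A \<longleftrightarrow> k \<in> B) \<longleftrightarrow> (\<forall>q\<in>{length xs<..k}. q \<in> A \<longleftrightarrow> k \<in> B)"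
    by auto
  then show ?thesis
    using links_col_cyc[OF assms, of p B] by (simp add: half_col_def assms(5))
qed

text \<open>In a half state the first northern vertex beyond the word is already joined to southern
  k, so k may be listed as a further entry; the permutations of an upward step can then move
  it.\<close>

lemma half_col_snoc:
  assumes "length xs < k"
  shows "half_col r (xs @ [k]) p k A B \<longleftrightarrow> half_col r xs p k A B"
proof -
  have "{length xs<..k} = insert (Suc (length xs)) {Suc (length xs)<..k}" using assms by auto
  then show ?thesis
    unfolding half_col_def links_col_def
    by (auto simp: nth_append less_Suc_eq all_conj_distrib)
qed

lemma glue_chain:
  assumes "m \<le> k"
  shows "(\<forall>i\<in>{m<..k}. i \<in> A \<longleftrightarrow> Suc i \<in> A) \<and> (Suc k \<in> A \<longleftrightarrow> b) \<longleftrightarrow> (\<forall>q\<in>{m<..Suc k}. q \<in> A \<longleftrightarrow> b)"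
  using assms
proof (induction rule: inc_induct)
  case base
  have "{k<..Suc k} = {Suc k}" by auto
  then show ?case by simp
next
  case (step m)
  have s: "{m<..k} = insert (Suc m) {Suc m<..k}" "{m<..Suc k} = insert (Suc m) {Suc m<..Suc k}"
    using step by auto
  have "(\<forall>i\<in>{m<..k}. i \<in> A \<longleftrightarrow> Suc i \<in> A) \<and> (Suc k \<in> A \<longleftrightarrow> b) \<longleftrightarrow>
      (Suc m \<in> A \<longleftrightarrow> Suc (Suc m) \<in> A) \<and> (\<forall>q\<in>{Suc m<..Suc k}. q \<in> A \<longleftrightarrow> b)"
    using step.IH unfolding s by auto
  also have "\<dots> \<longleftrightarrow> (Suc m \<in> A \<longleftrightarrow> b) \<and> (\<forall>q\<in>{Suc m<..Suc k}. q \<in> A \<longleftrightarrow> b)"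
  proof -
    have "Suc (Suc m) \<in> {Suc m<..Suc k}" using step by auto
    then show ?thesis by blast
  qed
  finally show ?case unfolding s by simp
qed

text \<open>Strand k + 1 is still an identity strand, so gluing the northern vertices from length xs
  + 1 to k + 1 attaches all of them to southern k + 1, which gets no predecessor.\<close>

lemma glue_links_zero:
  assumes "length xs \<le> k" "k < r"
  shows "(\<forall>i\<in>{length xs<..k}. i \<in> A \<longleftrightarrow> Suc i \<in> A) \<and> links_col r xs p k A B \<longleftrightarrow>
    half_col r xs p (Suc k) A B"
proof -
  have s: "{k<..r} = insert (Suc k) {Suc k<..r}" using assms by auto
  show ?thesis
    unfolding half_col_def links_col_def s
    using glue_chain[OF assms(1), of A "Suc k \<in> B"] by auto
qed

text \<open>The glued chain now begins at the northern vertex of the last entry x, so southern k + 1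
  joins the block of x; this is how a link arises. The entry must be nonzero because 0 encodes the
  absence of a link.\<close>

lemma glue_links_snoc:
  assumes "length zs < k" "k < r" "p (Suc k) = 0" "x \<noteq> 0"
  shows "(\<forall>i\<in>{length zs<..k}. i \<in> A \<longleftrightarrow> Suc i \<in> A) \<and> links_col r (zs @ [x]) p k A B \<longleftrightarrow>
    half_col r zs (p(Suc k := x)) (Suc k) A B"
proof -
  have s: "{k<..r} = insert (Suc k) {Suc k<..r}" using assms by auto
  define R where "R = {1..r} - {Suc k}"
  have t: "{1..r} = insert (Suc k) R" using assms by (auto simp: R_def)
  have "(\<forall>i\<in>R. (p(Suc k := x)) i \<noteq> 0 \<longrightarrow> (i \<in> B \<longleftrightarrow> (p(Suc k := x)) i \<in> B)) \<longleftrightarrow>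
      (\<forall>i\<in>R. p i \<noteq> 0 \<longrightarrow> (i \<in> B \<longleftrightarrow> p i \<in> B))"
    by (rule ball_cong) (auto simp: R_def)
  then have pp: "(\<forall>i\<in>{1..r}. (p(Suc k := x)) i \<noteq> 0 \<longrightarrow> (i \<in> B \<longleftrightarrow> (p(Suc k := x)) i \<in> B)) \<longleftrightarrow>
      (Suc k \<in> B \<longleftrightarrow> x \<in> B) \<and> (\<forall>i\<in>{1..r}. p i \<noteq> 0 \<longrightarrow> (i \<in> B \<longleftrightarrow> p i \<in> B))"
    unfolding t ball_simps using assms(3,4) by simp
  have l: "(\<forall>q<length (zs @ [x]). Suc q \<in> A \<longleftrightarrow> (zs @ [x]) ! q \<in> B) \<longleftrightarrow>
      (Suc (length zs) \<in> A \<longleftrightarrow> x \<in> B) \<and> (\<forall>q<length zs. Suc q \<in> A \<longleftrightarrow> zs ! q \<in> B)"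
    by (auto simp: nth_append less_Suc_eq)
  have m: "Suc (length zs) \<in> {length zs<..Suc k}" using assms by auto
  have "(\<forall>i\<in>{length zs<..k}. i \<in> A \<longleftrightarrow> Suc i \<in> A) \<and> links_col r (zs @ [x]) p k A B \<longleftrightarrow>
     (\<forall>q\<in>{length zs<..Suc k}. q \<in> A \<longleftrightarrow> Suc k \<in> B) \<and> (Suc (length zs) \<in> A \<longleftrightarrow> x \<in> B) \<and>
     (\<forall>q<length zs. Suc q \<in> A \<longleftrightarrow> zs ! q \<in> B) \<and> (\<forall>q\<in>{Suc k<..r}. q \<in> A \<longleftrightarrow> q \<in> B) \<and>
     (\<forall>i\<in>{1..r}. p i \<noteq> 0 \<longrightarrow> (i \<in> B \<longleftrightarrow> p i \<in> B))"
    unfolding links_col_def l s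
    using glue_chain[OF less_imp_le[OF assms(1)], of A "Suc k \<in> B"] by auto
  also have "\<dots> \<longleftrightarrow> half_col r zs (p(Suc k := x)) (Suc k) A B"
    unfolding half_col_def links_col_def pp using m by blast
  finally show ?thesis .
qed

text \<open>All northern vertices to be cut are joined to southern k, whose colour pins the middle
  vertices; so no component is lost.\<close>

lemma cut_half:
  assumes "representable r (half_col r xs p k)" "k \<le> r" "length xs \<le> k"
  shows "pa_mult n r (e_int n r (k - length xs) k) (diag r (half_col r xs p k)) = diag r (links_col r xs p k)"
    "representable r (links_col r xs p k)"
proof -
  have e: "k - (k - length xs) = length xs" using assms by simp
  have l: "k - length xs \<le> k" by simp
  let ?I = "{length xs<..k}"
  have forced: "i \<in> A \<longleftrightarrow> k \<in> B" if "half_col r xs p k A B" "i \<in> ?I" for A B i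
    using that by (auto simp: half_col_def)
  have C': "links_col r xs p k A B \<longleftrightarrow> half_col r xs p k ((A - ?I) \<union> {i \<in> ?I. k \<in> B}) B" for A B
    using assms(3) unfolding half_col_def links_col_def by auto
  have I: "?I \<subseteq> {1..r}" using assms by auto
  note rep = e_int_diag(2)[OF l assms(2), unfolded e]
  show "pa_mult n r (e_int n r (k - length xs) k) (diag r (half_col r xs p k)) = diag r (links_col r xs p k)"
    unfolding e_int_diag(1)[OF l assms(2)] e
    by (rule cut_mult(1)[where f = "\<lambda>B i. k \<in> B", OF rep assms(1)]) (use forced C' I in auto)
  show "representable r (links_col r xs p k)"
    by (rule cut_mult(2)[where f = "\<lambda>B i. k \<in> B", OF rep assms(1)]) (use forced C' I in auto)
qed

lemma glue_down_zero:
  assumes rep: "representable r (links_col r xs p k)" and k: "k < r" "length xs \<le> k"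
  shows "pa_mult n r (e_half n r (k - length xs) k) (diag r (links_col r xs p k)) =
      diag r (half_col r xs p (Suc k))"
    "representable r (half_col r xs p (Suc k))"
proof -
  have e: "k - (k - length xs) = length xs" using k by simp
  have l: "k - length xs \<le> k" by simp
  note rep' = e_half_diag(2)[OF l k(1), unfolded e]
  have "(\<lambda>A B. (\<forall>i\<in>{length xs<..k}. i \<in> A \<longleftrightarrow> Suc i \<in> A) \<and> links_col r xs p k A B) = half_col r xs p (Suc k)"
    by (intro ext glue_links_zero k)
  with glue_mult[OF rep' rep] show "pa_mult n r (e_half n r (k - length xs) k) (diag r (links_col r xs p k)) =
      diag r (half_col r xs p (Suc k))" "representable r (half_col r xs p (Suc k))"
    unfolding e_half_diag(1)[OF l k(1)] e by simp_all
qed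

lemma glue_down_pos:
  assumes rep: "representable r (links_col r xs p k)" and k: "k < r" "length xs \<le> k"
    and P: "1 \<le> P" "P \<le> length xs" and p: "p (Suc k) = 0" and x: "xs ! (P - 1) \<noteq> 0"
  shows "pa_mult n r (pa_mult n r (e_half n r (k - (length xs - 1)) k) (s_gen n r (length xs) P))
        (diag r (links_col r xs p k)) = diag r (half_col r (del (P - 1) xs) (p(Suc k := xs ! (P - 1))) (Suc k))"
    "representable r (half_col r (del (P - 1) xs) (p(Suc k := xs ! (P - 1))) (Suc k))"
proof -
  let ?zs = "del (P - 1) xs" and ?x = "xs ! (P - 1)"
  have len: "length ?zs = length xs - 1" using P by simp
  have "length xs \<in> {1..r}" "P \<in> {1..r}" using P k by auto
  note s = s_gen_diag[OF this, of n] and b = bij_cyc[OF this]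
  have cg: "links_col r xs p k (cyc (length xs) P ` A) B \<longleftrightarrow> links_col r (?zs @ [?x]) p k A B"
    if "A \<subseteq> {1..r}" for A B
    using P k that len by (intro links_col_cyc) (auto simp: nth_del_snoc[simplified])
  have 1: "pa_mult n r (s_gen n r (length xs) P) (diag r (links_col r xs p k)) = diag r (links_col r (?zs @ [?x]) p k)"
    using perm_mult(1)[OF _ rep b, of n] s diag_cong(1)[OF cg] by simp
  have 2: "representable r (links_col r (?zs @ [?x]) p k)"
    using perm_mult(2)[OF _ rep b] s diag_cong(2)[OF cg] by simp
  have e: "k - (k - (length xs - 1)) = length ?zs" using k len by simp
  have l: "k - (length xs - 1) \<le> k" by simp
  note rep' = e_half_diag(2)[OF l k(1), unfolded e]
  have "(\<lambda>A B. (\<forall>i\<in>{length ?zs<..k}. i \<in> A \<longleftrightarrow> Suc i \<in> A) \<and> links_col r (?zs @ [?x]) p k A B) =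
      half_col r ?zs (p(Suc k := ?x)) (Suc k)"
    using k P len by (intro ext glue_links_snoc p x) auto
  with glue_mult[OF rep' 2] 1 show "pa_mult n r (pa_mult n r (e_half n r (k - (length xs - 1)) k) (s_gen n r (length xs) P))
        (diag r (links_col r xs p k)) = diag r (half_col r ?zs (p(Suc k := ?x)) (Suc k))"
    "representable r (half_col r ?zs (p(Suc k := ?x)) (Suc k))"
    unfolding e_half_diag(1)[OF l k(1)] e pa_mult_assoc by simp_all
qed

text \<open>For P <= Q <= G the product s_{P,Q} s_{Q,G} is s_{P,G}. One summand of M followed by the
  permutation of the step thus puts the new vertex k at place P of the word.\<close>

lemma up_pos:
  assumes rep: "representable r (half_col r zs p k)" and k: "k \<le> r" "length zs < k"
    and P: "1 \<le> P" "P \<le> Q" "Q \<le> Suc (length zs)"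
  shows "pa_mult n r (pa_mult n r (pa_mult n r (e_int n r (k - Suc (length zs)) k) (s_gen n r P Q))
      (s_gen n r Q (Suc (length zs)))) (diag r (half_col r zs p k)) =
      diag r (links_col r (ins (P - 1) k zs) p k)"
    "representable r (links_col r (ins (P - 1) k zs) p k)"
proof -
  let ?G = "Suc (length zs)"
  have r: "P \<in> {1..r}" "Q \<in> {1..r}" "?G \<in> {1..r}" using P k by auto
  note s1 = s_gen_diag[OF r(1,2), of n] and s2 = s_gen_diag[OF r(2,3), of n]
    and b1 = bij_cyc[OF r(1,2)] and s3 = s_gen_diag[OF r(1,3), of n] and b3 = bij_cyc[OF r(1,3)]
  have "cyc Q ?G \<circ> cyc P Q = cyc P ?G"
    using P by (auto simp: fun_eq_iff cyc_def)
  then have s: "pa_mult n r (s_gen n r P Q) (s_gen n r Q ?G) = s_gen n r P ?G"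
    using perm_perm_mult(1)[OF _ _ b1, of "cyc Q ?G" n] s1 s2 s3 by simp
  have snoc: "half_col r zs p k = half_col r (zs @ [k]) p k"
    using half_col_snoc[OF k(2)] by (auto simp: fun_eq_iff)
  have cg: "half_col r (zs @ [k]) p k (cyc P ?G ` A) B \<longleftrightarrow> half_col r (ins (P - 1) k zs) p k A B"
    if "A \<subseteq> {1..r}" for A B
    using P k that by (intro half_col_cyc) (auto simp: nth_ins[simplified])
  have 1: "pa_mult n r (s_gen n r P ?G) (diag r (half_col r zs p k)) = diag r (half_col r (ins (P - 1) k zs) p k)"
    using perm_mult(1)[OF _ rep b3, of n] s3 diag_cong(1)[OF cg] unfolding snoc by simp
  have 2: "representable r (half_col r (ins (P - 1) k zs) p k)"
    using perm_mult(2)[OF _ rep b3] s3 diag_cong(2)[OF cg] unfolding snoc by simp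
  have len: "length (ins (P - 1) k zs) \<le> k" using k by simp
  show "pa_mult n r (pa_mult n r (pa_mult n r (e_int n r (k - Suc (length zs)) k) (s_gen n r P Q))
      (s_gen n r Q (Suc (length zs)))) (diag r (half_col r zs p k)) =
      diag r (links_col r (ins (P - 1) k zs) p k)"
    using cut_half(1)[OF 2 k(1) len, of n] 1 s by (simp add: pa_mult_assoc flip: pa_mult_assoc[of n r "s_gen n r P Q"])
  show "representable r (links_col r (ins (P - 1) k zs) p k)"
    by (rule cut_half(2)[OF 2 k(1) len])
qed

section \<open>Paths and their link data\<close>

lemma ins_nth_del: "j < length xs \<Longrightarrow> ins j (xs ! j) (del j xs) = xs"
  by (simp add: ins_def del_def min_def id_take_nth_drop[symmetric])

lemma del_ins: "j \<le> length ys \<Longrightarrow> del j (ins j x ys) = ys"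
  by (simp add: ins_def del_def min_def)

lemma nth_ins_same: "j \<le> length ys \<Longrightarrow> ins j x ys ! j = x"
  by (simp add: ins_def nth_append)

lemma set_ins: "set (ins j x ys) = insert x (set ys)"
  unfolding ins_def by (simp) (metis append_take_drop_id set_append)

lemma distinct_ins: "distinct (ins j x ys) \<longleftrightarrow> x \<notin> set ys \<and> distinct ys"
proof -
  have "distinct (ins j x ys) \<longleftrightarrow> x \<notin> set (take j ys @ drop j ys) \<and> distinct (take j ys @ drop j ys)"
    unfolding ins_def distinct_append set_append by auto
  then show ?thesis by (simp only: append_take_drop_id)
qed

lemma set_distinct_del:
  assumes "j < length xs" "distinct xs"
  shows "set (del j xs) = set xs - {xs ! j}" "distinct (del j xs)"
  using set_ins[of j "xs ! j" "del j xs"] distinct_ins[of j "xs ! j" "del j xs"] assms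
  by (auto simp: ins_nth_del)

lemma sorted_del:
  assumes "sorted (map f xs)" "j < length xs"
  shows "sorted (map f (del j xs))"
proof -
  have "sorted (map f (ins j (xs ! j) (del j xs)))" using assms by (simp add: ins_nth_del)
  then show ?thesis
    using assms by (auto simp: ins_def del_def sorted_append min_def)
qed

section \<open>Row words and prefix sums\<close>

lemma sorted_nth_le_iff:
  fixes ys :: "nat list"
  assumes "sorted ys" "j < length ys"
  shows "ys ! j \<le> v \<longleftrightarrow> j < length (filter (\<lambda>y. y \<le> v) ys)"
  using assms
proof (induction ys arbitrary: j)
  case (Cons y ys)
  show ?case
  proof (cases "y \<le> v")
    case True
    then show ?thesis using Cons by (cases j) auto
  next
    case False
    then have "\<forall>z\<in>set (y # ys). \<not> z \<le> v" using Cons.prems by auto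
    moreover from this have "filter (\<lambda>y. y \<le> v) (y # ys) = []" by (simp only: filter_empty_conv not_False_eq_True)
    ultimately show ?thesis using nth_mem[OF Cons.prems(2)] by (metis less_nat_zero_code list.size(3))
  qed
qed simp

text \<open>The word lists the boxes of lam row by row, each box named by the vertex filling it. Row
  v then occupies the places [lam]_{v-1} + 1 to [lam]_v, which is how prefix sums locate the strands
  moved by u.\<close>

definition row_word :: "(nat \<Rightarrow> nat) \<Rightarrow> (nat \<Rightarrow> nat) \<Rightarrow> nat list \<Rightarrow> bool" where
  "row_word b lam xs \<longleftrightarrow> sorted (map b xs) \<and> (\<forall>x\<in>set xs. b x \<noteq> 0) \<and>
     (\<forall>v\<ge>1. length (filter (\<lambda>x. b x = v) xs) = lam v)"

lemma row_word_prefix: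
  assumes "row_word b lam xs"
  shows "length (filter (\<lambda>x. b x \<le> v) xs) = pprefix lam v"
proof (induction v)
  case 0
  have "filter (\<lambda>x. b x \<le> 0) xs = []" using assms by (auto simp: row_word_def filter_empty_conv)
  then show ?case by (simp add: pprefix_def)
next
  case (Suc v)
  have "length (filter (\<lambda>x. b x \<le> Suc v) xs) =
      length (filter (\<lambda>x. b x \<le> v) xs) + length (filter (\<lambda>x. b x = Suc v) xs)"
    by (induction xs) auto
  then show ?case using Suc assms by (simp add: row_word_def pprefix_def)
qed

lemma row_word_size:
  assumes "row_word b lam xs" "lam 0 = 0" "finite {i. lam i \<noteq> 0}"
  shows "length xs = psize lam"
proof -
  \<comment> \<open>The last nonempty row, or 0 if there is none; the prefix sum up to it is the
    full size.\<close>
  define m where "m = Max (insert 0 {i. lam i \<noteq> 0})"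
  have m: "i \<le> m" if "lam i \<noteq> 0" for i
    using that assms(3) by (auto simp: m_def)
  have "b x \<le> m" if "x \<in> set xs" for x
  proof (rule m)
    have "filter (\<lambda>y. b y = b x) xs \<noteq> []" using that by (auto simp: filter_empty_conv)
    moreover have "b x \<ge> 1" using that assms(1) by (auto simp: row_word_def Suc_le_eq)
    ultimately show "lam (b x) \<noteq> 0" using assms(1) by (metis length_0_conv row_word_def)
  qed
  then have "filter (\<lambda>x. b x \<le> m) xs = xs" by simp
  then have "length xs = pprefix lam m" using row_word_prefix[OF assms(1), of m] by simp
  also have "\<dots> = psize lam"
    unfolding pprefix_def psize_def using m assms(2)
    by (intro sum.mono_neutral_right) (auto simp: Suc_le_eq dest: gr0_implies_Suc intro!: gr0I)
  finally show ?thesis .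
qed

lemma row_word_nth:
  assumes "row_word b lam xs" "j < length xs"
  shows "b (xs ! j) \<le> v \<longleftrightarrow> j < pprefix lam v"
  using sorted_nth_le_iff[of "map b xs" j v] assms row_word_prefix[OF assms(1), of v]
  by (simp add: row_word_def filter_map comp_def)

lemma row_word_prefix_le: "row_word b lam xs \<Longrightarrow> pprefix lam v \<le> length xs"
  using row_word_prefix[of b lam xs v] by (metis length_filter_le)

text \<open>Entries of index below [lam]_v have row at most v, and entries of index at least
  [lam]_{v-1} have row at least v; so every index between the two bounds, ends included, admits an
  entry of row v.\<close>

lemma row_word_sorted_ins:
  assumes "row_word b lam xs" "j \<le> pprefix lam v" "pprefix lam (v - 1) \<le> j" "b x = v" "1 \<le> v"
  shows "sorted (map b (ins j x xs))"
proof -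
  have s: "sorted (map b (take j xs @ drop j xs))" using assms by (simp add: row_word_def)
  have jl: "j \<le> length xs" using assms row_word_prefix_le[OF assms(1), of v] by simp
  have 1: "b y \<le> v" if y: "y \<in> set (take j xs)" for y
  proof -
    obtain i where i: "i < length (take j xs)" "y = take j xs ! i"
      using y by (metis in_set_conv_nth)
    then show ?thesis using row_word_nth[OF assms(1), of i v] assms by simp
  qed
  have 2: "v \<le> b y" if y: "y \<in> set (drop j xs)" for y
  proof -
    obtain i where i: "i < length (drop j xs)" "y = drop j xs ! i"
      using y by (metis in_set_conv_nth)
    then have "\<not> b y \<le> v - 1" using row_word_nth[OF assms(1), of "j + i" "v - 1"] assms jl by simp
    then show ?thesis using assms by simp
  qed
  show ?thesis
    using s 1 2 assms(4) unfolding ins_def map_append sorted_append by (auto intro: order_trans)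
qed

section \<open>Link data of a path\<close>

definition predecessors :: "(nat \<Rightarrow> nat) \<Rightarrow> (nat \<Rightarrow> nat) \<Rightarrow> nat \<Rightarrow> (nat \<Rightarrow> nat) \<Rightarrow> bool" where
  "predecessors a b j p \<longleftrightarrow> (\<forall>i. i \<notin> {1..j} \<longrightarrow> p i = 0) \<and>
     (\<forall>i\<in>{1..j}. if a i = 0 then p i = 0 else 1 \<le> p i \<and> p i < i \<and> b (p i) = a i) \<and>
     inj_on p {i \<in> {1..j}. a i \<noteq> 0}"

text \<open>The case j = k describes the state after step k, and j = k + 1 the half state in which
  step k + 1 has removed its box but not yet added one. The word lists the vertices whose blocks are
  still open, in every order that keeps the rows sorted.\<close>

definition link_data :: "(nat \<Rightarrow> nat) \<Rightarrow> (nat \<Rightarrow> nat) \<Rightarrow> nat \<Rightarrow> nat \<Rightarrow> (nat list \<times> (nat \<Rightarrow> nat)) set" where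
  "link_data a b j k = {(xs, p). predecessors a b j p \<and> distinct xs \<and>
     set xs = {i \<in> {1..k}. b i \<noteq> 0 \<and> i \<notin> range p} \<and> sorted (map b xs)}"

text \<open>Every vertex that added to row v is either still open or the predecessor of exactly one
  vertex that removed from row v.\<close>

lemma link_data_count:
  assumes "(xs, p) \<in> link_data a b j k" "j \<le> Suc k" "v \<ge> 1"
  shows "length (filter (\<lambda>x. b x = v) xs) + card {i \<in> {1..j}. a i = v} = card {i \<in> {1..k}. b i = v}"
proof -
  have p: "predecessors a b j p" and d: "distinct xs"
    and s: "set xs = {i \<in> {1..k}. b i \<noteq> 0 \<and> i \<notin> range p}"
    using assms by (auto simp: link_data_def)
  let ?J = "{i \<in> {1..j}. a i = v}"
  have pi: "1 \<le> p i \<and> p i \<le> k \<and> b (p i) = v" if "i \<in> ?J" for i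
    using p that assms(2,3) unfolding predecessors_def by fastforce
  have inj: "inj_on p ?J"
    using p assms(3) unfolding predecessors_def by (auto intro: inj_on_subset)
  have eq: "{i \<in> {1..k}. b i = v} = {x \<in> set xs. b x = v} \<union> p ` ?J"
  proof (intro equalityI subsetI)
    fix i assume i: "i \<in> {i \<in> {1..k}. b i = v}"
    show "i \<in> {x \<in> set xs. b x = v} \<union> p ` ?J"
    proof (cases "i \<in> range p")
      case False
      then show ?thesis using i s assms(3) by auto
    next
      case True
      then obtain l where l: "i = p l" by auto
      then have "p l \<noteq> 0" using i by auto
      then have "l \<in> {1..j}" "a l \<noteq> 0" "b (p l) = a l" using p unfolding predecessors_def by metis+
      then show ?thesis using i l by auto
    qed
  next
    fix i assume "i \<in> {x \<in> set xs. b x = v} \<union> p ` ?J"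
    then show "i \<in> {i \<in> {1..k}. b i = v}" using s pi by auto
  qed
  have "card {i \<in> {1..k}. b i = v} = card {x \<in> set xs. b x = v} + card (p ` ?J)"
    unfolding eq using s by (intro card_Un_disjoint) auto
  also have "card (p ` ?J) = card ?J" by (rule card_image[OF inj])
  also have "card {x \<in> set xs. b x = v} = length (filter (\<lambda>x. b x = v) xs)"
    using d by (metis distinct_card distinct_filter set_filter)
  finally show ?thesis by simp
qed

definition removed :: "(nat \<times> nat) list \<Rightarrow> nat \<Rightarrow> nat" where
  "removed t i = fst (t ! (i - 1))"

definition added :: "(nat \<times> nat) list \<Rightarrow> nat \<Rightarrow> nat" where
  "added t i = snd (t ! (i - 1))"

text \<open>A removal takes an existing box, so the truncated subtraction in \<open>rembox\<close>
  is exact and rows can be computed by counting additions and removals.\<close>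

definition valid_path :: "(nat \<times> nat) list \<Rightarrow> bool" where
  "valid_path t \<longleftrightarrow> (\<forall>k<length t. fst (t ! k) = 0 \<or> 0 < pstate t k (fst (t ! k)))"

lemma pstate_Suc: "k < length t \<Longrightarrow> pstate t (Suc k) = addbox (snd (t ! k)) (hstate t k)"
  by (simp add: pstate_def hstate_def take_Suc_conv_app_nth case_prod_beta)

lemma pstate_basic:
  assumes "k \<le> length t"
  shows "pstate t k 0 = 0 \<and> finite {i. pstate t k i \<noteq> 0}"
  using assms
proof (induction k)
  case 0
  then show ?case by (simp add: pstate_def pempty_def)
next
  case (Suc k)
  let ?S = "{i. pstate t k i \<noteq> 0}"
  have "{i. pstate t (Suc k) i \<noteq> 0} \<subseteq> insert (snd (t ! k)) ?S"
    using Suc.prems by (auto simp: pstate_Suc hstate_def addbox_def rembox_def split: if_splits)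
  moreover have "finite (insert (snd (t ! k)) ?S)" using Suc by simp
  ultimately have "finite {i. pstate t (Suc k) i \<noteq> 0}" by (rule finite_subset)
  moreover have "pstate t (Suc k) 0 = 0"
    using Suc by (auto simp: pstate_Suc hstate_def addbox_def rembox_def)
  ultimately show ?case by simp
qed

lemma hstate_basic:
  assumes "k \<le> length t"
  shows "hstate t k 0 = 0" "finite {i. hstate t k i \<noteq> 0}"
proof -
  show "hstate t k 0 = 0" using pstate_basic[OF assms] by (auto simp: hstate_def rembox_def)
  show "finite {i. hstate t k i \<noteq> 0}"
    by (rule finite_subset[OF _ conjunct2[OF pstate_basic[OF assms]]])
      (auto simp: hstate_def rembox_def split: if_splits)
qed

lemma card_Collect_Suc:
  "card {i \<in> {1..Suc k}. Q i} = card {i \<in> {1..k}. Q i} + (if Q (Suc k) then 1 else 0)"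
proof -
  have "{i \<in> {1..Suc k}. Q i} = (if Q (Suc k) then insert (Suc k) {i \<in> {1..k}. Q i} else {i \<in> {1..k}. Q i})"
    by (auto simp: le_Suc_eq)
  then show ?thesis by simp
qed

lemma hstate_count_step:
  assumes "valid_path t" "k < length t"
    and "pstate t k v + card {i \<in> {1..k}. removed t i = v} = card {i \<in> {1..k}. added t i = v}" "v \<ge> 1"
  shows "hstate t k v + card {i \<in> {1..Suc k}. removed t i = v} = card {i \<in> {1..k}. added t i = v}"
  using assms unfolding card_Collect_Suc valid_path_def
  by (auto simp: hstate_def rembox_def removed_def)

lemma pstate_count:
  assumes "valid_path t" "k \<le> length t" "v \<ge> 1"
  shows "pstate t k v + card {i \<in> {1..k}. removed t i = v} = card {i \<in> {1..k}. added t i = v}"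
  using assms(2)
proof (induction k)
  case 0
  then show ?case by (simp add: pstate_def pempty_def)
next
  case (Suc k)
  then have "hstate t k v + card {i \<in> {1..Suc k}. removed t i = v} = card {i \<in> {1..k}. added t i = v}"
    by (intro hstate_count_step assms) auto
  then show ?case
    unfolding card_Collect_Suc[of k "\<lambda>i. added t i = v"] using assms(3) Suc.prems
    by (auto simp: pstate_Suc addbox_def added_def)
qed

lemma hstate_count:
  assumes "valid_path t" "k < length t" "v \<ge> 1"
  shows "hstate t k v + card {i \<in> {1..Suc k}. removed t i = v} = card {i \<in> {1..k}. added t i = v}"
  using assms by (intro hstate_count_step pstate_count) auto

text \<open>The count by open vertices and the count by boxes agree, so the word has as many entries
  of row v as the state has boxes there.\<close>

lemma link_data_row_word:
  assumes "valid_path t" "k \<le> length t" "(xs, p) \<in> link_data (removed t) (added t) k k"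
  shows "row_word (added t) (pstate t k) xs" "length xs = psize (pstate t k)"
proof -
  have "length (filter (\<lambda>x. added t x = v) xs) = pstate t k v" if "v \<ge> 1" for v
    using link_data_count[OF assms(3) _ that] pstate_count[OF assms(1,2) that] by simp
  then show *: "row_word (added t) (pstate t k) xs"
    using assms(3) by (auto simp: row_word_def link_data_def)
  show "length xs = psize (pstate t k)"
    using row_word_size[OF *] pstate_basic[OF assms(2)] by simp
qed

lemma link_data_row_word_half:
  assumes "valid_path t" "k < length t" "(xs, p) \<in> link_data (removed t) (added t) (Suc k) k"
  shows "row_word (added t) (hstate t k) xs" "length xs = psize (hstate t k)"
proof -
  have "length (filter (\<lambda>x. added t x = v) xs) = hstate t k v" if "v \<ge> 1" for v
    using link_data_count[OF assms(3) _ that] hstate_count[OF assms(1,2) that] by simp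
  then show *: "row_word (added t) (hstate t k) xs"
    using assms(3) by (auto simp: row_word_def link_data_def)
  show "length xs = psize (hstate t k)"
    using row_word_size[OF *] hstate_basic[OF less_imp_le[OF assms(2)]] by simp
qed

lemma link_data_length:
  assumes "(xs, p) \<in> link_data a b j k"
  shows "length xs \<le> k"
proof -
  have "length xs = card (set xs)" using assms by (auto simp: link_data_def simp del: set_eq_iff dest: distinct_card)
  also have "\<dots> \<le> card {1..k}" using assms by (intro card_mono) (auto simp: link_data_def)
  finally show ?thesis by simp
qed

section \<open>Link data through one half step\<close>

lemma pprefix_pred: "v \<ge> 1 \<Longrightarrow> pprefix lam v = pprefix lam (v - 1) + lam v"
  by (cases v) (auto simp: pprefix_def)

lemma pprefix_rembox:
  assumes "c \<ge> 1" "lam c > 0"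
  shows "pprefix (rembox c lam) c = pprefix lam c - 1" "pprefix (rembox c lam) (c - 1) = pprefix lam (c - 1)"
proof -
  show *: "pprefix (rembox c lam) (c - 1) = pprefix lam (c - 1)"
    unfolding pprefix_def using assms by (intro sum.cong) (auto simp: rembox_def)
  show "pprefix (rembox c lam) c = pprefix lam c - 1"
    unfolding pprefix_pred[OF assms(1)] * using assms by (simp add: rembox_def)
qed

lemma pprefix_addbox:
  assumes "c \<ge> 1"
  shows "pprefix (addbox c lam) c = Suc (pprefix lam c)" "pprefix (addbox c lam) (c - 1) = pprefix lam (c - 1)"
proof -
  show *: "pprefix (addbox c lam) (c - 1) = pprefix lam (c - 1)"
    unfolding pprefix_def using assms by (intro sum.cong) (auto simp: addbox_def)
  show "pprefix (addbox c lam) c = Suc (pprefix lam c)"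
    unfolding pprefix_pred[OF assms(1)] * using assms by (simp add: addbox_def)
qed

text \<open>Injectivity at one more index means that its predecessor is not yet in use. As the other
  values are 0 or predecessors in use, this can be said with \<open>range\<close>, the form that
  matches the open vertices in \<open>link_data\<close>.\<close>

lemma predecessors_Suc:
  "predecessors a b (Suc k) p \<longleftrightarrow> predecessors a b k (p(Suc k := 0)) \<and>
     (if a (Suc k) = 0 then p (Suc k) = 0
      else 1 \<le> p (Suc k) \<and> p (Suc k) \<le> k \<and> b (p (Suc k)) = a (Suc k) \<and>
        p (Suc k) \<notin> range (p(Suc k := 0)))"
proof -
  let ?p = "p(Suc k := 0)" and ?S = "{i \<in> {1..k}. a i \<noteq> 0}"
  have ins: "{1..Suc k} = insert (Suc k) {1..k}" by auto
  have 1: "(\<forall>i. i \<notin> {1..Suc k} \<longrightarrow> p i = 0) \<longleftrightarrow> (\<forall>i. i \<notin> {1..k} \<longrightarrow> ?p i = 0)"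
    unfolding ins by auto
  have 2: "(\<forall>i\<in>{1..k}. if a i = 0 then p i = 0 else 1 \<le> p i \<and> p i < i \<and> b (p i) = a i) \<longleftrightarrow>
      (\<forall>i\<in>{1..k}. if a i = 0 then ?p i = 0 else 1 \<le> ?p i \<and> ?p i < i \<and> b (?p i) = a i)"
    by (rule ball_cong) auto
  have 3: "inj_on ?p ?S \<longleftrightarrow> inj_on p ?S" by (rule inj_on_cong) auto
  have 4: "{i \<in> {1..Suc k}. a i \<noteq> 0} = (if a (Suc k) = 0 then ?S else insert (Suc k) ?S)"
    unfolding ins by auto
  have 5: "p (Suc k) \<in> range ?p \<longleftrightarrow> p (Suc k) \<in> p ` ?S"
    if "1 \<le> p (Suc k)" "predecessors a b k ?p"
  proof
    assume "p (Suc k) \<in> range ?p"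
    then obtain i where i: "p (Suc k) = ?p i" by (rule rangeE)
    then have "?p i \<noteq> 0" using that(1) by auto
    then have "i \<in> ?S" using that(2) unfolding predecessors_def mem_Collect_eq by metis
    moreover have "?p i = p i" using \<open>?p i \<noteq> 0\<close> by (auto split: if_splits)
    ultimately show "p (Suc k) \<in> p ` ?S" using i by auto
  next
    assume "p (Suc k) \<in> p ` ?S"
    then obtain i where "i \<in> ?S" "p (Suc k) = p i" by auto
    then show "p (Suc k) \<in> range ?p" by (intro image_eqI[of _ _ i]) auto
  qed
  have 6: "?S - {Suc k} = ?S" by auto
  show ?thesis
  proof (cases "a (Suc k) = 0")
    case True
    then show ?thesis
      unfolding predecessors_def 1 4 3 unfolding ins ball_simps 2 by auto
  next
    case False
    have "predecessors a b (Suc k) p \<longleftrightarrow> predecessors a b k ?p \<and>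
      (1 \<le> p (Suc k) \<and> p (Suc k) \<le> k \<and> b (p (Suc k)) = a (Suc k) \<and> p (Suc k) \<notin> p ` ?S)"
      using False unfolding predecessors_def 1 4 3 unfolding ins ball_simps 2 
      by (simp only: if_False inj_on_insert 6 less_Suc_eq_le) blast
    also have "\<dots> \<longleftrightarrow> predecessors a b k ?p \<and>
      (1 \<le> p (Suc k) \<and> p (Suc k) \<le> k \<and> b (p (Suc k)) = a (Suc k) \<and> p (Suc k) \<notin> range ?p)"
      using 5 by blast
    finally show ?thesis using False by simp
  qed
qed

lemma link_data_down_zero:
  assumes "a (Suc k) = 0"
  shows "link_data a b (Suc k) k = link_data a b k k"
proof -
  have "predecessors a b (Suc k) p = predecessors a b k p" for p
  proof -
    have "p (Suc k) = 0 \<Longrightarrow> p(Suc k := 0) = p" by auto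
    moreover have "predecessors a b k p \<Longrightarrow> p (Suc k) = 0"
      by (auto simp: predecessors_def)
    ultimately show ?thesis unfolding predecessors_Suc using assms by auto
  qed
  then show ?thesis by (simp add: link_data_def)
qed

lemma link_data_up_zero:
  assumes "b (Suc k) = 0"
  shows "link_data a b j (Suc k) = link_data a b j k"
proof -
  have "{i \<in> {1..Suc k}. b i \<noteq> 0 \<and> i \<notin> range p} = {i \<in> {1..k}. b i \<noteq> 0 \<and> i \<notin> range p}" for p :: "nat \<Rightarrow> nat"
    using assms by (auto simp: le_Suc_eq)
  then show ?thesis by (simp only: link_data_def)
qed

text \<open>The vertex in the last box of the row leaves the word and becomes the predecessor of k +
  1. Conversely, every admissible predecessor arises once: it is put back at the end of its row, the
  order within a row being unrestricted.\<close>

lemma link_data_down_bij: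
  assumes t: "valid_path t" "k < length t" and pos: "removed t (Suc k) \<noteq> 0"
    and P: "P = pprefix (pstate t k) (removed t (Suc k))"
  shows "bij_betw (\<lambda>(xs, p). (del (P - 1) xs, p(Suc k := xs ! (P - 1))))
      (link_data (removed t) (added t) k k) (link_data (removed t) (added t) (Suc k) k)"
    and "(xs, p) \<in> link_data (removed t) (added t) k k \<Longrightarrow> 1 \<le> P \<and> P \<le> length xs \<and> xs ! (P - 1) \<noteq> 0"
proof -
  let ?a = "removed t" and ?b = "added t" and ?c = "removed t (Suc k)"
  let ?f = "\<lambda>(xs, p). (del (P - 1) xs, p(Suc k := xs ! (P - 1)))"
  let ?g = "\<lambda>(ys, p). (ins (P - 1) (p (Suc k)) ys, p(Suc k := (0::nat)))"
  have c: "?c = fst (t ! k)" by (simp add: removed_def)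
  have pc: "0 < pstate t k ?c" using t pos by (auto simp: valid_path_def c)
  have c1: "1 \<le> ?c" using pos by simp
  have hst: "hstate t k = rembox ?c (pstate t k)" by (simp add: hstate_def c)
  have P1: "P = pprefix (pstate t k) (?c - 1) + pstate t k ?c"
    unfolding P by (rule pprefix_pred[OF c1])
  have fwd: "1 \<le> P \<and> P \<le> length xs \<and> ?b (xs ! (P - 1)) = ?c" if x: "(xs, p) \<in> link_data ?a ?b k k" for xs p
  proof -
    note rw = link_data_row_word(1)[OF t(1) less_imp_le[OF t(2)] x]
    have a: "1 \<le> P" using P1 pc by simp
    have b: "P \<le> length xs" unfolding P by (rule row_word_prefix_le[OF rw])
    have "?b (xs ! (P - 1)) \<le> ?c" "\<not> ?b (xs ! (P - 1)) \<le> ?c - 1"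
      using row_word_nth[OF rw, of "P - 1"] a b P P1 pc by auto
    then show ?thesis using a b by simp
  qed
  have xk: "xs ! (P - 1) \<in> set xs" if x: "(xs, p) \<in> link_data ?a ?b k k" for xs p
    using fwd[OF x] by (intro nth_mem) auto
  {
    fix xs p assume x: "(xs, p) \<in> link_data ?a ?b k k"
    show "1 \<le> P \<and> P \<le> length xs \<and> xs ! (P - 1) \<noteq> 0"
      using fwd[OF x] xk[OF x] x by (auto simp: link_data_def)
  }
  show "bij_betw ?f (link_data ?a ?b k k) (link_data ?a ?b (Suc k) k)"
  proof (rule bij_betw_byWitness[where f' = ?g])
    show "\<forall>z\<in>link_data ?a ?b k k. ?g (?f z) = z"
    proof
      fix z assume "z \<in> link_data ?a ?b k k"
      then obtain xs p where z: "z = (xs, p)" and x: "(xs, p) \<in> link_data ?a ?b k k" by (cases z) auto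
      have "p (Suc k) = 0" using x by (auto simp: link_data_def predecessors_def)
      moreover have "P - 1 < length xs" using fwd[OF x] by auto
      ultimately show "?g (?f z) = z" unfolding z by (auto simp: ins_nth_del)
    qed
    \<comment> \<open>After the removal the prefix sum up to row \<open>?c\<close> is P - 1, so
      index P - 1 is the end of that row.\<close>
    have bwd: "P - 1 \<le> length ys \<and> sorted (map ?b (ins (P - 1) (p (Suc k)) ys))"
      if y: "(ys, p) \<in> link_data ?a ?b (Suc k) k" for ys p
    proof -
      note rw = link_data_row_word_half(1)[OF t y]
      have e: "pprefix (hstate t k) ?c = P - 1" "pprefix (hstate t k) (?c - 1) = pprefix (pstate t k) (?c - 1)"
        unfolding hst P using pprefix_rembox[of ?c "pstate t k", OF c1 pc] by auto
      have "?b (p (Suc k)) = ?c" using y pos by (auto simp: link_data_def predecessors_Suc)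
      then have "sorted (map ?b (ins (P - 1) (p (Suc k)) ys))"
        using e P1 pc c1 by (intro row_word_sorted_ins[OF rw, where v = ?c]) auto
      then show ?thesis using row_word_prefix_le[OF rw, of ?c] e by simp
    qed
    show "\<forall>z\<in>link_data ?a ?b (Suc k) k. ?f (?g z) = z"
    proof
      fix z assume "z \<in> link_data ?a ?b (Suc k) k"
      then obtain ys p where z: "z = (ys, p)" and "(ys, p) \<in> link_data ?a ?b (Suc k) k" by (cases z) auto
      then show "?f (?g z) = z" using bwd unfolding z by (auto simp: del_ins nth_ins_same)
    qed
    show "?f ` link_data ?a ?b k k \<subseteq> link_data ?a ?b (Suc k) k"
    proof (rule image_subsetI)
      fix z assume "z \<in> link_data ?a ?b k k"
      then obtain xs p where z: "z = (xs, p)" and x: "(xs, p) \<in> link_data ?a ?b k k" by (cases z) auto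
      let ?x = "xs ! (P - 1)"
      have d: "predecessors ?a ?b k p" "distinct xs" "set xs = {i \<in> {1..k}. ?b i \<noteq> 0 \<and> i \<notin> range p}"
        "sorted (map ?b xs)" using x by (auto simp: link_data_def)
      have pk: "p (Suc k) = 0" using d by (auto simp: predecessors_def)
      have l: "P - 1 < length xs" using fwd[OF x] by auto
      have x1: "?x \<in> {1..k}" "?x \<notin> range p" "?b ?x = ?c"
        using xk[OF x] fwd[OF x] unfolding d(3) by auto
      have upd: "p(Suc k := 0) = p" using pk by auto
      have "predecessors ?a ?b (Suc k) (p(Suc k := ?x))"
        unfolding predecessors_Suc fun_upd_upd fun_upd_same upd using d(1) x1 pos by simp
      moreover have "set (del (P - 1) xs) = {i \<in> {1..k}. ?b i \<noteq> 0 \<and> i \<notin> range (p(Suc k := ?x))}"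
      proof -
        have "i \<in> range (p(Suc k := ?x)) \<longleftrightarrow> i \<in> range p \<or> i = ?x" if "i \<in> {1..k}" for i
        proof -
          have "i \<in> range (p(Suc k := ?x)) \<longleftrightarrow> (\<exists>l. l \<noteq> Suc k \<and> i = p l) \<or> i = ?x"
            by (auto simp: image_iff)
          moreover have "i \<noteq> p (Suc k)" using that pk by auto
          ultimately show ?thesis by (metis rangeE rangeI)
        qed
        then show ?thesis unfolding set_distinct_del(1)[OF l d(2)] d(3) by blast
      qed
      ultimately show "?f z \<in> link_data ?a ?b (Suc k) k"
        unfolding z link_data_def using set_distinct_del(2)[OF l d(2)] sorted_del[OF d(4) l] by simp
    qed
    show "?g ` link_data ?a ?b (Suc k) k \<subseteq> link_data ?a ?b k k"
    proof (rule image_subsetI)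
      fix z assume "z \<in> link_data ?a ?b (Suc k) k"
      then obtain ys p where z: "z = (ys, p)" and y: "(ys, p) \<in> link_data ?a ?b (Suc k) k" by (cases z) auto
      let ?x = "p (Suc k)" and ?p = "p(Suc k := 0)"
      have d: "predecessors ?a ?b (Suc k) p" "distinct ys" "set ys = {i \<in> {1..k}. ?b i \<noteq> 0 \<and> i \<notin> range p}"
        using y by (auto simp: link_data_def)
      have q: "predecessors ?a ?b k ?p" "1 \<le> ?x" "?x \<le> k" "?b ?x = ?c" "?x \<notin> range ?p"
        using d(1) pos unfolding predecessors_Suc by auto
      have "?x \<notin> set ys" unfolding d(3) by auto
      moreover have "insert ?x (set ys) = {i \<in> {1..k}. ?b i \<noteq> 0 \<and> i \<notin> range ?p}"
      proof -
        have "i \<in> range p \<longleftrightarrow> i \<in> range ?p \<or> i = ?x" if "i \<in> {1..k}" for i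
        proof -
          have "i \<in> range p \<longleftrightarrow> (\<exists>l. l \<noteq> Suc k \<and> i = p l) \<or> i = ?x"
          proof
            assume "i \<in> range p"
            then obtain l where "i = p l" by (rule rangeE)
            then show "(\<exists>l. l \<noteq> Suc k \<and> i = p l) \<or> i = ?x" by (cases "l = Suc k") auto
          qed auto
          moreover have "i \<in> range ?p \<longleftrightarrow> (\<exists>l. l \<noteq> Suc k \<and> i = p l)"
            using that by (auto simp: image_iff)
          ultimately show ?thesis by blast
        qed
        then show ?thesis unfolding d(3) using q pos by auto
      qed
      ultimately show "?g z \<in> link_data ?a ?b k k"
        unfolding z link_data_def using q(1) d(2) bwd[OF y] by (simp add: distinct_ins set_ins)
    qed
  qed
qed

lemma ins_inject:
  assumes "ins j x ys = ins j' x ys'" "x \<notin> set ys" "x \<notin> set ys'" "j \<le> length ys" "j' \<le> length ys'"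
  shows "j = j' \<and> ys = ys'"
proof -
  have "x \<notin> set (take j ys)" "x \<notin> set (take j' ys')"
    using assms by (auto dest: in_set_takeD)
  then have "take j ys = take j' ys' \<and> drop j ys = drop j' ys'"
    using assms(1) unfolding ins_def by (metis append_Cons_eq_iff assms(2,3) in_set_dropD)
  then show ?thesis using assms(4,5) by (metis append_take_drop_id length_take min.absorb2)
qed

text \<open>The new vertex may take any place in its row, the index i counting from the end of the
  row as in M. There are as many places as boxes in the enlarged row, and the way back deletes k + 1
  from the word.\<close>

lemma link_data_up_bij:
  assumes t: "valid_path t" "k < length t" and pos: "added t (Suc k) \<noteq> 0"
    and Q: "Q = pprefix (pstate t (Suc k)) (added t (Suc k))"
  shows "bij_betw (\<lambda>((ys, p), i). (ins (Q - i - 1) (Suc k) ys, p))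
      (link_data (removed t) (added t) (Suc k) k \<times> {..<pstate t (Suc k) (added t (Suc k))})
      (link_data (removed t) (added t) (Suc k) (Suc k))"
    and "(ys, p) \<in> link_data (removed t) (added t) (Suc k) k \<Longrightarrow> Q \<le> Suc (length ys)"
    and "pstate t (Suc k) (added t (Suc k)) \<le> Q"
proof -
  let ?a = "removed t" and ?b = "added t" and ?c = "added t (Suc k)"
  let ?G = "pstate t (Suc k)"
  let ?f = "\<lambda>((ys, p), i). (ins (Q - i - 1) (Suc k) ys, p)"
  have c: "?c = snd (t ! k)" by (simp add: added_def)
  have c1: "1 \<le> ?c" using pos by simp
  have st: "?G = addbox ?c (hstate t k)" using t by (simp add: pstate_Suc c)
  have Q1: "Q = pprefix ?G (?c - 1) + ?G ?c"
    unfolding Q by (rule pprefix_pred[OF c1])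
  then show "?G ?c \<le> Q" by simp
  have e: "Q = Suc (pprefix (hstate t k) ?c)" "pprefix (hstate t k) (?c - 1) = Q - ?G ?c"
    using pprefix_addbox[OF c1, of "hstate t k"] Q1 unfolding Q st by auto
  have len: "Q \<le> Suc (length ys)" if y: "(ys, p) \<in> link_data ?a ?b (Suc k) k" for ys p
    unfolding e(1) using row_word_prefix_le[OF link_data_row_word_half(1)[OF t y], of ?c] by simp
  then show "(ys, p) \<in> link_data ?a ?b (Suc k) k \<Longrightarrow> Q \<le> Suc (length ys)" .
  \<comment> \<open>Vertex k + 1 is still open: predecessors are smaller than their successors, and
    only the removals up to k + 1 have occurred.\<close>
  have notin: "Suc k \<notin> range p" if "predecessors ?a ?b (Suc k) p" for p
  proof
    assume "Suc k \<in> range p"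
    then obtain i where i: "p i = Suc k" by auto
    then have "i \<in> {1..Suc k}" "p i < i" using that unfolding predecessors_def by (metis nat.distinct(1))+
    then show False using i by auto
  qed
  have open_Suc: "{i \<in> {1..Suc k}. ?b i \<noteq> 0 \<and> i \<notin> range p} = insert (Suc k) {i \<in> {1..k}. ?b i \<noteq> 0 \<and> i \<notin> range p}"
    if "predecessors ?a ?b (Suc k) p" for p
    using notin[OF that] pos by (auto simp: le_Suc_eq)
  show "bij_betw ?f (link_data ?a ?b (Suc k) k \<times> {..<?G ?c}) (link_data ?a ?b (Suc k) (Suc k))"
    unfolding bij_betw_def
  proof
    show "inj_on ?f (link_data ?a ?b (Suc k) k \<times> {..<?G ?c})"
    proof (rule inj_onI)
      fix z z'
      assume z: "z \<in> link_data ?a ?b (Suc k) k \<times> {..<?G ?c}" "z' \<in> link_data ?a ?b (Suc k) k \<times> {..<?G ?c}"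
        and zz: "?f z = ?f z'"
      obtain ys p i ys' p' i' where zd: "z = ((ys, p), i)" "z' = ((ys', p'), i')"
        by (metis prod.exhaust)
      have y: "(ys, p) \<in> link_data ?a ?b (Suc k) k" "i < ?G ?c"
        and y': "(ys', p') \<in> link_data ?a ?b (Suc k) k" "i' < ?G ?c"
        and eq: "ins (Q - i - 1) (Suc k) ys = ins (Q - i' - 1) (Suc k) ys'" and pp: "p = p'"
        using z zz unfolding zd by auto
      have "Suc k \<notin> set ys" "Suc k \<notin> set ys'" using y y' by (auto simp: link_data_def)
      then have "Q - i - 1 = Q - i' - 1 \<and> ys = ys'"
        using len[OF y(1)] len[OF y'(1)] by (intro ins_inject[OF eq]) auto
      then show "z = z'" unfolding zd pp using y(2) y'(2) Q1 by auto
    qed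
    show "?f ` (link_data ?a ?b (Suc k) k \<times> {..<?G ?c}) = link_data ?a ?b (Suc k) (Suc k)"
    proof (intro equalityI subsetI)
      fix z assume "z \<in> ?f ` (link_data ?a ?b (Suc k) k \<times> {..<?G ?c})"
      then obtain ys p i where z: "z = (ins (Q - i - 1) (Suc k) ys, p)"
        and y: "(ys, p) \<in> link_data ?a ?b (Suc k) k" and i: "i < ?G ?c" by auto
      have "sorted (map ?b (ins (Q - i - 1) (Suc k) ys))"
        using e i Q1 c1 by (intro row_word_sorted_ins[OF link_data_row_word_half(1)[OF t y], where v = ?c]) auto
      moreover have "Suc k \<notin> set ys" using y by (auto simp: link_data_def)
      ultimately show "z \<in> link_data ?a ?b (Suc k) (Suc k)"
        using y unfolding z link_data_def mem_Collect_eq prod.case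
        by (simp only: open_Suc set_ins distinct_ins simp_thms)
    next
      fix z assume z: "z \<in> link_data ?a ?b (Suc k) (Suc k)"
      obtain xs p where [simp]: "z = (xs, p)" by (cases z)
      have x: "(xs, p) \<in> link_data ?a ?b (Suc k) (Suc k)" using z by simp
      have d: "predecessors ?a ?b (Suc k) p" "distinct xs"
        "set xs = insert (Suc k) {i \<in> {1..k}. ?b i \<noteq> 0 \<and> i \<notin> range p}" "sorted (map ?b xs)"
        using x open_Suc by (auto simp: link_data_def simp del: Collect_case_prod)
      have "Suc k \<in> set xs" using d(3) by simp
      then obtain j where j: "j < length xs" "xs ! j = Suc k" by (metis in_set_conv_nth)
      have "Suc k \<le> length t" using t by simp
      note rw = link_data_row_word(1)[OF t(1) this x]
      have jQ: "j < Q" "Q - ?G ?c \<le> j"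
        using row_word_nth[OF rw j(1), of ?c] row_word_nth[OF rw j(1), of "?c - 1"] j(2) c1 Q Q1 by auto
      have "(del j xs, p) \<in> link_data ?a ?b (Suc k) k"
        unfolding link_data_def using d(1) set_distinct_del[OF j(1) d(2)] d(3) j(2) sorted_del[OF d(4) j(1)]
        by auto
      \<comment> \<open>With k + 1 at index j, exactly Q - 1 - j entries of its row follow it; this
        number is the summation index of M.\<close>
      moreover have "Q - 1 - j < ?G ?c" using jQ Q1 by auto
      moreover have "Q - (Q - 1 - j) - 1 = j" using jQ by auto
      then have "z = ?f ((del j xs, p), Q - 1 - j)" using ins_nth_del[OF j(1)] j(2) by simp
      ultimately show "z \<in> ?f ` (link_data ?a ?b (Suc k) k \<times> {..<?G ?c})" by blast
    qed
  qed
qed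

section \<open>Expansion of u along a path\<close>

text \<open>A downward factor sends each diagram to a single diagram, so the sum is merely
  reindexed.\<close>

lemma u_down_sum:
  assumes t: "valid_path t" "k < r" "length t = r"
    and fin: "finite (link_data (removed t) (added t) k k)"
    and rep: "\<And>xs p. (xs, p) \<in> link_data (removed t) (added t) k k \<Longrightarrow> representable r (links_col r xs p k)"
  shows "pa_mult n r (u_down n r t k)
        (\<Sum>(xs, p)\<in>link_data (removed t) (added t) k k. diag r (links_col r xs p k)) =
      (\<Sum>(ys, p)\<in>link_data (removed t) (added t) (Suc k) k. diag r (half_col r ys p (Suc k)))"
    (is "pa_mult n r _ (sum ?d ?S) = sum ?h ?H")
    and "finite (link_data (removed t) (added t) (Suc k) k)"
    and "(ys, p) \<in> link_data (removed t) (added t) (Suc k) k \<Longrightarrow> representable r (half_col r ys p (Suc k))"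
proof -
  have kt: "k < length t" "k \<le> length t" using t by auto
  have c: "removed t (Suc k) = fst (t ! k)" by (simp add: removed_def)
  have "\<exists>g. bij_betw g ?S ?H \<and> (\<forall>z\<in>?S. pa_mult n r (u_down n r t k) (?d z) = ?h (g z) \<and>
      representable r (half_col r (fst (g z)) (snd (g z)) (Suc k)))"
  proof (cases "removed t (Suc k) = 0")
    case True
    have "pa_mult n r (u_down n r t k) (diag r (links_col r xs p k)) = diag r (half_col r xs p (Suc k)) \<and>
        representable r (half_col r xs p (Suc k))" if x: "(xs, p) \<in> ?S" for xs p
    proof -
      have "hstate t k = pstate t k" using True by (simp add: hstate_def c rembox_def)
      \<comment> \<open>For a = 0 the prefix sum is 0, and s_{l,0} = 1 by convention.\<close>
      then have "u_down n r t k = pa_mult n r (e_half n r (k - length xs) k) (pa_one r)"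
        using link_data_row_word(2)[OF t(1) kt(2) x] True
        by (simp add: u_down_def s_gen_def pprefix_def c)
      then show ?thesis
        using glue_down_zero(1)[OF rep[OF x] t(2) link_data_length[OF x], where n = n]
          glue_down_zero(2)[OF rep[OF x] t(2) link_data_length[OF x]] rep[OF x]
        by (simp add: pa_mult_assoc pa_mult_one_left)
    qed
    then show ?thesis
      unfolding link_data_down_zero[where a = "removed t", OF True] by (intro exI[of _ id]) auto
  next
    case False
    define P where "P = pprefix (pstate t k) (removed t (Suc k))"
    let ?g = "\<lambda>(xs, p). (del (P - 1) xs, p(Suc k := xs ! (P - 1)))"
    note B = link_data_down_bij[OF t(1) kt(1) False P_def]
    have "pa_mult n r (u_down n r t k) (diag r (links_col r xs p k)) = ?h (?g (xs, p)) \<and>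
        representable r (half_col r (fst (?g (xs, p))) (snd (?g (xs, p))) (Suc k))" if x: "(xs, p) \<in> ?S" for xs p
    proof -
      note P = B(2)[OF x]
      have "?g (xs, p) \<in> ?H" using bspec[OF bij_betwE[OF B(1)] x] .
      then have "length (del (P - 1) xs) = psize (hstate t k)"
        using link_data_row_word_half(2)[OF t(1) kt(1)] by simp
      moreover have "P - 1 < length xs" using P by linarith
      ultimately have "psize (hstate t k) = length xs - 1" by simp
      then have "u_down n r t k = pa_mult n r (e_half n r (k - (length xs - 1)) k) (s_gen n r (length xs) P)"
        using link_data_row_word(2)[OF t(1) kt(2) x] by (simp add: u_down_def Let_def P_def c)
      moreover have "p (Suc k) = 0" using x by (auto simp: link_data_def predecessors_def)
      ultimately show ?thesis
        using glue_down_pos(1)[OF rep[OF x] t(2) link_data_length[OF x], where P = P and n = n]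
          glue_down_pos(2)[OF rep[OF x] t(2) link_data_length[OF x], where P = P] P by simp
    qed
    then show ?thesis using B(1) by (intro exI[of _ ?g] conjI ballI) (auto split: prod.splits)
  qed
  then obtain g where g: "bij_betw g ?S ?H"
    and g1: "\<And>z. z \<in> ?S \<Longrightarrow> pa_mult n r (u_down n r t k) (?d z) = ?h (g z)"
    and g2: "\<And>z. z \<in> ?S \<Longrightarrow> representable r (half_col r (fst (g z)) (snd (g z)) (Suc k))" by blast
  show "pa_mult n r (u_down n r t k) (sum ?d ?S) = sum ?h ?H"
  proof -
    have "pa_mult n r (u_down n r t k) (sum ?d ?S) = (\<Sum>z\<in>?S. ?h (g z))"
      unfolding pa_mult_sum_right by (intro sum.cong refl g1)
    also have "\<dots> = sum ?h ?H" by (rule sum.reindex_bij_betw[OF g])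
    finally show ?thesis .
  qed
  show "finite ?H" using g fin bij_betw_finite by blast
  show "representable r (half_col r ys p (Suc k))" if y: "(ys, p) \<in> ?H"
  proof -
    obtain z where "z \<in> ?S" "(ys, p) = g z"
      using y unfolding bij_betw_imp_surj_on[OF g, symmetric] by (rule imageE)
    then show ?thesis using g2[of z] by (metis fst_conv snd_conv)
  qed
qed

text \<open>An upward factor that adds a box sends each diagram to a sum over the places of the new
  vertex. Over all link data of the half state, these sums exhaust the link data of the next state,
  each once.\<close>

lemma u_up_sum:
  assumes t: "valid_path t" "k < r" "length t = r"
    and fin: "finite (link_data (removed t) (added t) (Suc k) k)"
    and rep: "\<And>ys p. (ys, p) \<in> link_data (removed t) (added t) (Suc k) k \<Longrightarrow>
      representable r (half_col r ys p (Suc k))"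
  shows "pa_mult n r (u_up n r t k)
        (\<Sum>(ys, p)\<in>link_data (removed t) (added t) (Suc k) k. diag r (half_col r ys p (Suc k))) =
      (\<Sum>(xs, p)\<in>link_data (removed t) (added t) (Suc k) (Suc k). diag r (links_col r xs p (Suc k)))"
    (is "pa_mult n r _ (sum ?h ?H) = sum ?d ?S")
    and "finite (link_data (removed t) (added t) (Suc k) (Suc k))"
    and "(xs, p) \<in> link_data (removed t) (added t) (Suc k) (Suc k) \<Longrightarrow>
      representable r (links_col r xs p (Suc k))"
proof -
  have kt: "k < length t" "Suc k \<le> r" using t by auto
  have c: "added t (Suc k) = snd (t ! k)" by (simp add: added_def)
  have "pa_mult n r (u_up n r t k) (sum ?h ?H) = sum ?d ?S \<and> finite ?S \<and>
    (\<forall>xs p. (xs, p) \<in> ?S \<longrightarrow> representable r (links_col r xs p (Suc k)))"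
  proof (cases "added t (Suc k) = 0")
    case True
    have e: "pa_mult n r (u_up n r t k) (diag r (half_col r ys p (Suc k))) = diag r (links_col r ys p (Suc k)) \<and>
        representable r (links_col r ys p (Suc k))" if y: "(ys, p) \<in> ?H" for ys p
    proof -
      have "pstate t (Suc k) = hstate t k" using True kt by (simp add: pstate_Suc c addbox_def)
      then have "u_up n r t k = pa_mult n r (pa_mult n r (e_int n r (Suc k - length ys) (Suc k)) (pa_one r)) (pa_one r)"
        using link_data_row_word_half(2)[OF t(1) kt(1) y] True
        by (simp add: u_up_def s_gen_def M_elem_def pprefix_def c)
      then show ?thesis
        using cut_half(1)[OF rep[OF y] kt(2), where n = n] cut_half(2)[OF rep[OF y] kt(2)]
          link_data_length[OF y] rep[OF y]
        by (simp add: pa_mult_assoc pa_mult_one_left)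
    qed
    show ?thesis
      unfolding link_data_up_zero[where b = "added t", OF True] pa_mult_sum_right
      using fin e by (auto intro!: sum.cong)
  next
    case False
    define Q where "Q = pprefix (pstate t (Suc k)) (added t (Suc k))"
    let ?c = "pstate t (Suc k) (added t (Suc k))"
    let ?f = "\<lambda>((ys, p), i). (ins (Q - i - 1) (Suc k) ys, p)"
    note B = link_data_up_bij[OF t(1) kt(1) False Q_def]
    have e: "pa_mult n r (pa_mult n r (pa_mult n r (e_int n r (Suc k - Suc (length ys)) (Suc k)) (s_gen n r (Q - i) Q))
        (s_gen n r Q (Suc (length ys)))) (diag r (half_col r ys p (Suc k))) =
        diag r (links_col r (ins (Q - i - 1) (Suc k) ys) p (Suc k)) \<and>
        representable r (links_col r (ins (Q - i - 1) (Suc k) ys) p (Suc k))"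
      if y: "(ys, p) \<in> ?H" and i: "i < ?c" for ys p i
      using up_pos(1)[OF rep[OF y] kt(2), where P = "Q - i" and Q = Q and n = n]
        up_pos(2)[OF rep[OF y] kt(2), where P = "Q - i" and Q = Q] link_data_length[OF y] B(2)[OF y] B(3) i
      by auto
    have step: "pa_mult n r (u_up n r t k) (?h z) = (\<Sum>i<?c. ?d (?f (z, i)))" if z: "z \<in> ?H" for z
    proof -
      obtain ys p where zd: "z = (ys, p)" and y: "(ys, p) \<in> ?H" using z by (cases z) auto
      \<comment> \<open>Read off from the insertion with i = 0, which exists because the row just
        enlarged is not empty.\<close>
      have size: "psize (pstate t (Suc k)) = Suc (length ys)"
      proof -
        have "0 < ?c" using False kt by (simp add: pstate_Suc c addbox_def)
        then have "?f ((ys, p), 0) \<in> ?S" using bspec[OF bij_betwE[OF B(1)], of "((ys, p), 0)"] y by simp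
        then have "length (ins (Q - 0 - 1) (Suc k) ys) = psize (pstate t (Suc k))"
          using link_data_row_word(2)[OF t(1), of "Suc k" "ins (Q - 0 - 1) (Suc k) ys" p] kt t(3) by simp
        then show ?thesis by simp
      qed
      have "u_up n r t k = (\<Sum>i<?c. pa_mult n r (pa_mult n r
          (e_int n r (Suc k - Suc (length ys)) (Suc k)) (s_gen n r (Q - i) Q)) (s_gen n r Q (Suc (length ys))))"
        using False by (simp add: u_up_def Let_def size M_elem_def Q_def c pa_mult_sum_left pa_mult_sum_right)
      then have "pa_mult n r (u_up n r t k) (?h z) = (\<Sum>i<?c. pa_mult n r (pa_mult n r (pa_mult n r
          (e_int n r (Suc k - Suc (length ys)) (Suc k)) (s_gen n r (Q - i) Q)) (s_gen n r Q (Suc (length ys))))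
          (diag r (half_col r ys p (Suc k))))"
        by (simp add: zd pa_mult_sum_left)
      also have "\<dots> = (\<Sum>i<?c. ?d (?f (z, i)))"
        using e[OF y] by (intro sum.cong refl) (auto simp: zd)
      finally show ?thesis .
    qed
    have "pa_mult n r (u_up n r t k) (sum ?h ?H) = (\<Sum>z\<in>?H. \<Sum>i<?c. ?d (?f (z, i)))"
      unfolding pa_mult_sum_right by (intro sum.cong refl step)
    also have "\<dots> = (\<Sum>w\<in>?H \<times> {..<?c}. ?d (?f w))"
      by (simp add: sum.cartesian_product case_prod_beta)
    also have "\<dots> = sum ?d ?S"
      by (rule sum.reindex_bij_betw[OF B(1)])
    finally have 1: "pa_mult n r (u_up n r t k) (sum ?h ?H) = sum ?d ?S" .
    have 2: "finite ?S" using B(1) fin bij_betw_finite[OF B(1)] by blast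
    have 3: "representable r (links_col r xs p (Suc k))" if x: "(xs, p) \<in> ?S" for xs p
    proof -
      obtain w where w: "(xs, p) = ?f w" "w \<in> ?H \<times> {..<?c}"
        using x unfolding bij_betw_imp_surj_on[OF B(1), symmetric] by (rule imageE)
      obtain ys q i where "w = ((ys, q), i)" by (metis prod.exhaust)
      then show ?thesis using w e[of ys q i] by auto
    qed
    show ?thesis using 1 2 3 by blast
  qed
  then show "pa_mult n r (u_up n r t k) (sum ?h ?H) = sum ?d ?S" "finite ?S"
    "(xs, p) \<in> ?S \<Longrightarrow> representable r (links_col r xs p (Suc k))" by blast+
qed

lemma link_data_0: "link_data a b 0 0 = {([], \<lambda>_. 0)}"
  by (auto simp: link_data_def predecessors_def)

lemma u_prod_expansion:
  assumes t: "valid_path t" "length t = r" and "k \<le> r"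
  shows "u_prod n r t k = (\<Sum>(xs, p)\<in>link_data (removed t) (added t) k k. diag r (links_col r xs p k)) \<and>
    finite (link_data (removed t) (added t) k k) \<and>
    (\<forall>xs p. (xs, p) \<in> link_data (removed t) (added t) k k \<longrightarrow> representable r (links_col r xs p k))"
  using assms(3)
proof (induction k)
  case 0
  \<comment> \<open>Before any step the word is empty, there are no links and all r strands are
    identity strands.\<close>
  have "A = B \<longleftrightarrow> links_col r [] (\<lambda>_. 0) 0 A B" if "A \<subseteq> {1..r}" "B \<subseteq> {1..r}" for A B
  proof -
    have "(\<forall>q\<in>{0<..r}. q \<in> A \<longleftrightarrow> q \<in> B) \<longleftrightarrow> A = B"
    proof -
      have "{0<..r} = {1..r}" by auto
      then show ?thesis using that by blast
    qed
    then show ?thesis by (simp add: links_col_def)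
  qed
  note diag_cong[of r "(=)" "links_col r [] (\<lambda>_. 0) 0", OF this]
  then show ?case using pa_one_diag[of r] by (simp add: link_data_0)
next
  case (Suc k)
  let ?S = "link_data (removed t) (added t) k k"
  have k: "k < r" using Suc.prems by simp
  have IH: "u_prod n r t k = (\<Sum>(xs, p)\<in>?S. diag r (links_col r xs p k))" "finite ?S"
    "\<And>xs p. (xs, p) \<in> ?S \<Longrightarrow> representable r (links_col r xs p k)"
    using Suc by auto
  note d = u_down_sum[OF t(1) k t(2) IH(2,3)]
  note u = u_up_sum[OF t(1) k t(2) d(2,3)]
  show ?case
    using u(2,3) by (simp add: pa_mult_assoc IH(1) d(1) u(1))
qed

lemma u_path_expansion:
  assumes "valid_path t" "length t = r"
  shows "u_path n r t = (\<Sum>(xs, p)\<in>link_data (removed t) (added t) r r. diag r (links_col r xs p r))"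
    and "finite (link_data (removed t) (added t) r r)"
    and "(xs, p) \<in> link_data (removed t) (added t) r r \<Longrightarrow> representable r (links_col r xs p r)"
  using u_prod_expansion[OF assms order_refl, of n] by (auto simp: u_path_def)

section \<open>Exchanging two steps\<close>

lemma predecessors_cong:
  assumes "\<And>i. i \<in> {1..r} \<Longrightarrow> a i = a' i" "\<And>i. i \<in> {1..r} \<Longrightarrow> b i = b' i"
    and p: "predecessors a b r p"
  shows "predecessors a' b' r p"
proof -
  have S: "{i \<in> {1..r}. a i \<noteq> 0} = {i \<in> {1..r}. a' i \<noteq> 0}" using assms(1) by auto
  have "if a' i = 0 then p i = 0 else 1 \<le> p i \<and> p i < i \<and> b' (p i) = a' i" if i: "i \<in> {1..r}" for i
  proof -
    have "if a i = 0 then p i = 0 else 1 \<le> p i \<and> p i < i \<and> b (p i) = a i"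
      using p i unfolding predecessors_def by blast
    moreover have "p i \<in> {1..r}" if "1 \<le> p i" "p i < i" using that i by auto
    ultimately show ?thesis using assms(1)[OF i] assms(2)[of "p i"] by auto
  qed
  then show ?thesis using p unfolding predecessors_def S by blast
qed

lemma link_data_cong:
  assumes "\<And>i. i \<in> {1..r} \<Longrightarrow> a i = a' i" "\<And>i. i \<in> {1..r} \<Longrightarrow> b i = b' i"
  shows "link_data a b r r = link_data a' b' r r"
proof -
  have p: "predecessors a b r p \<longleftrightarrow> predecessors a' b' r p" for p
    using predecessors_cong[of r a a' b b' p] predecessors_cong[of r a' a b' b p] assms by metis
  have s: "{i \<in> {1..r}. b i \<noteq> 0 \<and> i \<notin> range p} = {i \<in> {1..r}. b' i \<noteq> 0 \<and> i \<notin> range p}"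
    for p :: "nat \<Rightarrow> nat" using assms(2) by auto
  have m: "map b xs = map b' xs" if "set xs = {i \<in> {1..r}. Q i}" for xs Q
    using that assms(2) by auto
  have "(xs, p) \<in> link_data a b r r \<longleftrightarrow> (xs, p) \<in> link_data a' b' r r" for xs p
    unfolding link_data_def mem_Collect_eq prod.case p s using m[of xs] by metis
  then show ?thesis by auto
qed

text \<open>By the count, the additions to row L before k are as many as the removals from row L up
  to k. Injectivity makes the latter use up the former, so k + 1 can only choose k. Conversely, once
  k + 1 is linked to k, no other link involves the label of k, and the two labels can be replaced
  together.\<close>

lemma predecessors_marked:
  assumes k: "1 \<le> k" "k < r" and u: "b k = a (Suc k)" "a (Suc k) \<noteq> 0" and L: "L \<noteq> 0"
    and cnt: "card {i \<in> {1..k}. a i = L} = card {i \<in> {1..k - 1}. b i = L}"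
  shows "predecessors (a(Suc k := L)) (b(k := L)) r p \<longleftrightarrow> predecessors a b r p \<and> p (Suc k) = k"
proof -
  let ?a = "a(Suc k := L)" and ?b = "b(k := L)" and ?S = "{i \<in> {1..r}. a i \<noteq> 0}"
  have S: "{i \<in> {1..r}. ?a i \<noteq> 0} = ?S" using u L by auto
  have kS: "Suc k \<in> ?S" using k u by auto
  show ?thesis
  proof
    assume p: "predecessors ?a ?b r p"
    have zero: "\<forall>i. i \<notin> {1..r} \<longrightarrow> p i = 0" and inj: "inj_on p ?S"
      and c: "\<And>i. i \<in> {1..r} \<Longrightarrow> if ?a i = 0 then p i = 0 else 1 \<le> p i \<and> p i < i \<and> ?b (p i) = ?a i"
      using p unfolding predecessors_def S by blast+
    have x: "1 \<le> p (Suc k)" "p (Suc k) \<le> k" "?b (p (Suc k)) = L"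
      using c[of "Suc k"] k L by auto
    have pk: "p (Suc k) = k"
    proof (rule ccontr)
      assume ne: "p (Suc k) \<noteq> k"
      let ?I = "{i \<in> {1..k}. a i = L}" and ?J = "{i \<in> {1..k - 1}. b i = L}"
      have IS: "?I \<subseteq> ?S" using k L by auto
      have "p ` ?I \<subseteq> ?J"
      proof (rule image_subsetI)
        fix i assume i: "i \<in> ?I"
        then have "1 \<le> p i" "p i < i" "?b (p i) = L" using c[of i] k L by auto
        then show "p i \<in> ?J" using i by (auto split: if_splits)
      qed
      moreover have "card (p ` ?I) = card ?J"
        using card_image[OF inj_on_subset[OF inj IS]] cnt by simp
      ultimately have "p ` ?I = ?J" by (intro card_subset_eq) auto
      moreover have "p (Suc k) \<in> ?J" using x ne by auto
      ultimately obtain i where i: "i \<in> ?I" "p (Suc k) = p i" by (metis (no_types, lifting) imageE)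
      then have "Suc k = i" using inj_onD[OF inj i(2) kS] IS by auto
      then show False using i by auto
    qed
    have "if a i = 0 then p i = 0 else 1 \<le> p i \<and> p i < i \<and> b (p i) = a i" if i: "i \<in> {1..r}" for i
    proof (cases "i = Suc k")
      case True
      then show ?thesis using pk u k by simp
    next
      case False
      have "p i \<noteq> k" if "a i \<noteq> 0"
        using inj_onD[OF inj, of i "Suc k"] pk kS False i that by auto
      then show ?thesis using c[OF i] False by auto
    qed
    then show "predecessors a b r p \<and> p (Suc k) = k"
      using zero inj pk unfolding predecessors_def by blast
  next
    assume p: "predecessors a b r p \<and> p (Suc k) = k"
    have inj: "inj_on p ?S"
      and c: "\<And>i. i \<in> {1..r} \<Longrightarrow> if a i = 0 then p i = 0 else 1 \<le> p i \<and> p i < i \<and> b (p i) = a i"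
      using p unfolding predecessors_def by blast+
    have "if ?a i = 0 then p i = 0 else 1 \<le> p i \<and> p i < i \<and> ?b (p i) = ?a i" if i: "i \<in> {1..r}" for i
    proof (cases "i = Suc k")
      case True
      then show ?thesis using p k L by simp
    next
      case False
      have "p i \<noteq> k" if "a i \<noteq> 0"
        using inj_onD[OF inj, of i "Suc k"] p kS False i that by auto
      then show ?thesis using c[OF i] False by auto
    qed
    then show "predecessors ?a ?b r p"
      using p inj unfolding predecessors_def S by blast
  qed
qed

text \<open>Being a predecessor, k is not open, so neither the word nor its sorting sees the new
  label of k.\<close>

lemma link_data_marked:
  assumes "1 \<le> k" "k < r" "b k = a (Suc k)" "a (Suc k) \<noteq> 0" "L \<noteq> 0"
    and "card {i \<in> {1..k}. a i = L} = card {i \<in> {1..k - 1}. b i = L}"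
  shows "link_data (a(Suc k := L)) (b(k := L)) r r = {z \<in> link_data a b r r. snd z (Suc k) = k}"
proof -
  have "(xs, p) \<in> link_data (a(Suc k := L)) (b(k := L)) r r \<longleftrightarrow>
      (xs, p) \<in> link_data a b r r \<and> p (Suc k) = k" for xs p
  proof (cases "p (Suc k) = k")
    case True
    then have k: "k \<in> range p" by (metis rangeI)
    then have s: "{i \<in> {1..r}. (b(k := L)) i \<noteq> 0 \<and> i \<notin> range p} = {i \<in> {1..r}. b i \<noteq> 0 \<and> i \<notin> range p}"
      by auto
    have m: "map (b(k := L)) xs = map b xs" if "set xs = {i \<in> {1..r}. b i \<noteq> 0 \<and> i \<notin> range p}"
      using that k by auto
    show ?thesis
      unfolding link_data_def mem_Collect_eq prod.case s predecessors_marked[OF assms]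
      by (cases "set xs = {i \<in> {1..r}. b i \<noteq> 0 \<and> i \<notin> range p}") (simp_all only: m True simp_thms)
  next
    case False
    then show ?thesis
      unfolding link_data_def mem_Collect_eq prod.case predecessors_marked[OF assms] by simp
  qed
  then show ?thesis by auto
qed

section \<open>Relabelling by an adjacent transposition\<close>

abbreviation conjugate :: "nat \<Rightarrow> nat list \<times> (nat \<Rightarrow> nat) \<Rightarrow> nat list \<times> (nat \<Rightarrow> nat)" where
  "conjugate k z \<equiv> (map (transpose k (Suc k)) (fst z),
     transpose k (Suc k) \<circ> snd z \<circ> transpose k (Suc k))"

lemma transpose_less:
  assumes "m < j" "\<not> (m = k \<and> j = Suc k)"
  shows "transpose k (Suc k) m < transpose k (Suc k) j"
  using assms by (auto simp: transpose_def)

text \<open>An adjacent transposition reverses the order of a single pair, so p i < i survives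
  unless k + 1 is linked to k. The word keeps its sequence of row labels. The new data again have no
  link from k + 1 to k, for that would require p k = k + 1.\<close>

lemma conjugate_link_data:
  assumes k: "1 \<le> k" "k < r" and z: "z \<in> link_data a b r r" "snd z (Suc k) \<noteq> k"
    and ab: "a' = a \<circ> transpose k (Suc k)" "b' = b \<circ> transpose k (Suc k)"
  shows "conjugate k z \<in> link_data a' b' r r \<and> snd (conjugate k z) (Suc k) \<noteq> k"
proof -
  let ?t = "transpose k (Suc k)"
  obtain xs p where zd: "z = (xs, p)" by (cases z)
  let ?p = "?t \<circ> p \<circ> ?t"
  have p: "predecessors a b r p" and d: "distinct xs" "set xs = {i \<in> {1..r}. b i \<noteq> 0 \<and> i \<notin> range p}"
      "sorted (map b xs)" and ne: "p (Suc k) \<noteq> k"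
    using z by (auto simp: zd link_data_def)
  have zero: "\<And>i. i \<notin> {1..r} \<Longrightarrow> p i = 0" and inj: "inj_on p {i \<in> {1..r}. a i \<noteq> 0}"
    and c: "\<And>i. i \<in> {1..r} \<Longrightarrow> if a i = 0 then p i = 0 else 1 \<le> p i \<and> p i < i \<and> b (p i) = a i"
    using p unfolding predecessors_def by blast+
  have tr: "?t i \<in> {1..r} \<longleftrightarrow> i \<in> {1..r}" for i
    using k by (auto simp: transpose_def)
  have t0: "?t i = 0 \<longleftrightarrow> i = 0" for i
    using k by (auto simp: transpose_def)
  have tinj: "?t i = ?t j \<longleftrightarrow> i = j" for i j
    by (metis transpose_involutory)
  have t1: "1 \<le> ?t i \<longleftrightarrow> 1 \<le> i" for i
    using t0[of i] by linarith
  have "predecessors a' b' r ?p"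
    unfolding predecessors_def
  proof (intro conjI allI impI ballI)
    fix i assume "i \<notin> {1..r}"
    then have "?t i \<notin> {1..r}" using tr by blast
    then have "p (?t i) = 0" by (rule zero)
    then show "?p i = 0" by (simp add: t0)
  next
    fix i assume i: "i \<in> {1..r}"
    have "?t (p (?t i)) < i" if "p (?t i) < ?t i"
    proof -
      have "\<not> (p (?t i) = k \<and> ?t i = Suc k)" using ne by auto
      from transpose_less[OF that this] show ?thesis by simp
    qed
    moreover have "?t i \<in> {1..r}" using i tr by blast
    note c[OF this]
    ultimately show "if a' i = 0 then ?p i = 0 else 1 \<le> ?p i \<and> ?p i < i \<and> b' (?p i) = a' i"
      unfolding ab comp_apply t0 t1 transpose_involutory by presburger
  next
    show "inj_on ?p {i \<in> {1..r}. a' i \<noteq> 0}"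
    proof (rule inj_onI)
      fix i j assume ij: "i \<in> {i \<in> {1..r}. a' i \<noteq> 0}" "j \<in> {i \<in> {1..r}. a' i \<noteq> 0}" "?p i = ?p j"
      then have "p (?t i) = p (?t j)" by (simp only: comp_apply tinj)
      moreover have "?t i \<in> {i \<in> {1..r}. a i \<noteq> 0}" "?t j \<in> {i \<in> {1..r}. a i \<noteq> 0}"
        using ij tr ab by auto
      ultimately have "?t i = ?t j" by (rule inj_onD[OF inj])
      then show "i = j" by (simp only: tinj)
    qed
  qed
  moreover have "distinct (map ?t xs)"
    using d by (simp add: distinct_map)
  moreover have "set (map ?t xs) = {i \<in> {1..r}. b' i \<noteq> 0 \<and> i \<notin> range ?p}"
  proof -
    have r: "i \<in> range ?p \<longleftrightarrow> ?t i \<in> range p" for i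
    proof
      assume "i \<in> range ?p"
      then obtain j where "i = ?p j" by (rule rangeE)
      then show "?t i \<in> range p" by simp
    next
      assume "?t i \<in> range p"
      then obtain j where "?t i = p j" by (rule rangeE)
      then have "i = ?p (?t j)" by (metis comp_apply transpose_involutory)
      then show "i \<in> range ?p" by (rule range_eqI)
    qed
    have im: "i \<in> ?t ` set xs \<longleftrightarrow> ?t i \<in> set xs" for i
      by (metis image_iff transpose_involutory)
    show ?thesis
    proof (rule set_eqI)
      fix i
      have "i \<in> set (map ?t xs) \<longleftrightarrow> ?t i \<in> {1..r} \<and> b (?t i) \<noteq> 0 \<and> ?t i \<notin> range p"
        unfolding set_map im unfolding d(2) by blast
      then show "i \<in> set (map ?t xs) \<longleftrightarrow> i \<in> {i \<in> {1..r}. b' i \<noteq> 0 \<and> i \<notin> range ?p}"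
        unfolding tr r ab by simp
    qed
  qed
  moreover have "sorted (map b' (map ?t xs))"
  proof -
    have "map b' (map ?t xs) = map b xs" by (simp add: ab)
    then show ?thesis using d(3) by metis
  qed
  moreover have "?p (Suc k) \<noteq> k"
  proof
    assume "?p (Suc k) = k"
    then have "?t (p k) = ?t (Suc k)" by simp
    then have "p k = Suc k" by (simp only: tinj)
    moreover have "p k < k \<or> p k = 0" using c[of k] k by (auto split: if_splits)
    ultimately show False by simp
  qed
  ultimately show ?thesis
    unfolding link_data_def zd fst_conv snd_conv mem_Collect_eq prod.case by blast
qed

lemma conjugate_conjugate: "conjugate k (conjugate k z) = z"
  by (cases z) (simp add: comp_def map_idI)

lemma conjugate_bij:
  assumes k: "1 \<le> k" "k < r"
    and ab: "a' = a \<circ> transpose k (Suc k)" "b' = b \<circ> transpose k (Suc k)"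
  shows "bij_betw (conjugate k) {z \<in> link_data a b r r. snd z (Suc k) \<noteq> k}
    {z \<in> link_data a' b' r r. snd z (Suc k) \<noteq> k}"
proof (rule bij_betw_byWitness[where f' = "conjugate k"])
  have ab': "a = a' \<circ> transpose k (Suc k)" "b = b' \<circ> transpose k (Suc k)"
    using ab by (auto simp: fun_eq_iff)
  show "conjugate k ` {z \<in> link_data a b r r. snd z (Suc k) \<noteq> k} \<subseteq> {z \<in> link_data a' b' r r. snd z (Suc k) \<noteq> k}"
    by (rule image_subsetI) (use conjugate_link_data[OF k _ _ ab] in blast)
  show "conjugate k ` {z \<in> link_data a' b' r r. snd z (Suc k) \<noteq> k} \<subseteq> {z \<in> link_data a b r r. snd z (Suc k) \<noteq> k}"
    by (rule image_subsetI) (use conjugate_link_data[OF k _ _ ab'] in blast)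
qed (auto simp only: conjugate_conjugate)

text \<open>The transposition is stacked below, so it acts on the southern set and leaves A
  alone.\<close>

lemma diag_mult_s_adj:
  assumes "representable r C" "1 \<le> k" "k < r"
  shows "pa_mult n r (diag r C) (s_adj r k) = diag r (\<lambda>A B. C A (transpose k (Suc k) ` B))"
proof -
  let ?t = "transpose k (Suc k)"
  have k: "1 \<le> k" "Suc k \<le> r" using assms by auto
  have tr: "?t i \<in> {1..r} \<longleftrightarrow> i \<in> {1..r}" for i
    using k by (auto simp: transpose_def)
  have mem: "i \<in> ?t ` B \<longleftrightarrow> ?t i \<in> B" for i B
    by (metis image_iff transpose_involutory)
  have eq: "perm_col r ?t m B \<longleftrightarrow> m = ?t ` B" if "m \<subseteq> {1..r}" "B \<subseteq> {1..r}" for m B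
  proof -
    have "i \<in> m \<longleftrightarrow> ?t i \<in> B" if "i \<notin> {1..r}" for i
      using that tr[of i] \<open>m \<subseteq> {1..r}\<close> \<open>B \<subseteq> {1..r}\<close> by blast
    then show ?thesis unfolding perm_col_def set_eq_iff mem by blast
  qed
  have sub: "?t ` B \<subseteq> {1..r}" if "B \<subseteq> {1..r}" for B
    using that tr by auto
  show ?thesis
    unfolding s_adj_diag(1)[OF k]
  proof (rule diag_mult(1)[OF assms(1) s_adj_diag(2)[OF k]])
    fix A B :: "nat set" assume "A \<subseteq> {1..r}" "B \<subseteq> {1..r}"
    then show "C A (?t ` B) \<longleftrightarrow> (\<exists>m\<subseteq>{1..r}. C A m \<and> perm_col r ?t m B)"
      using eq sub by metis
  qed (use eq in auto)
qed

text \<open>Relabelling the southern vertices amounts to relabelling word and links, once the link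
  conditions are reindexed along the transposition of {1..r}.\<close>

lemma links_col_transpose:
  assumes "1 \<le> k" "k < r"
  shows "links_col r xs p r A (transpose k (Suc k) ` B) \<longleftrightarrow>
    links_col r (fst (conjugate k (xs, p))) (snd (conjugate k (xs, p))) r A B"
proof -
  let ?t = "transpose k (Suc k)"
  have mem: "i \<in> ?t ` B \<longleftrightarrow> ?t i \<in> B" for i B
    by (metis image_iff transpose_involutory)
  have t0: "?t i = 0 \<longleftrightarrow> i = 0" for i
    using assms by (auto simp: transpose_def)
  have im: "{1..r} = ?t ` {1..r}"
    using bij_transpose[of k r] assms by (simp add: bij_betw_def)
  have "(\<forall>i\<in>{1..r}. p i \<noteq> 0 \<longrightarrow> (?t i \<in> B \<longleftrightarrow> ?t (p i) \<in> B)) \<longleftrightarrow>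
      (\<forall>i\<in>?t ` {1..r}. p i \<noteq> 0 \<longrightarrow> (?t i \<in> B \<longleftrightarrow> ?t (p i) \<in> B))"
    using im by simp
  also have "\<dots> \<longleftrightarrow> (\<forall>j\<in>{1..r}. ?t (p (?t j)) \<noteq> 0 \<longrightarrow> (j \<in> B \<longleftrightarrow> ?t (p (?t j)) \<in> B))"
    by (simp only: ball_simps t0 transpose_involutory)
  finally show ?thesis
    by (simp add: links_col_def mem)
qed

text \<open>The vertices k and k + 1 share a block, so a saturated southern set contains both or
  neither and is fixed by the transposition.\<close>

lemma links_col_arc:
  assumes "1 \<le> k" "k < r" "p (Suc k) = k"
  shows "links_col r xs p r A (transpose k (Suc k) ` B) \<longleftrightarrow> links_col r xs p r A B"
proof -
  let ?t = "transpose k (Suc k)"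
  have mem: "i \<in> ?t ` B \<longleftrightarrow> ?t i \<in> B" for i B
    by (metis image_iff transpose_involutory)
  have arc: "Suc k \<in> B \<longleftrightarrow> k \<in> B" if "links_col r xs p r A B" for B
    using that assms unfolding links_col_def by auto
  have fixed: "?t ` B = B" if "Suc k \<in> B \<longleftrightarrow> k \<in> B" for B
    using that unfolding set_eq_iff mem by (auto simp: transpose_def)
  show ?thesis
  proof
    assume l: "links_col r xs p r A (?t ` B)"
    have "Suc k \<in> B \<longleftrightarrow> k \<in> B" using arc[OF l] by (simp add: mem)
    then show "links_col r xs p r A B" using l fixed by simp
  next
    assume l: "links_col r xs p r A B"
    then show "links_col r xs p r A (?t ` B)" using fixed[OF arc[OF l]] by simp
  qed
qed

section \<open>The path rerouted through a new row\<close>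

lemma Std_valid_path: "t \<in> Std r nu \<Longrightarrow> valid_path t \<and> length t = r"
  by (auto simp: Std_def valid_path_def)

text \<open>Rows decrease, so if row \<open>plen lam + 1\<close> were nonzero, all rows before it
  would be too, one more than the length allows.\<close>

lemma is_part_plen:
  assumes "is_part lam"
  shows "lam (plen lam + 1) = 0"
proof (rule ccontr)
  assume ne: "lam (plen lam + 1) \<noteq> 0"
  have anti: "lam j \<le> lam i" if "1 \<le> i" "i \<le> j" for i j
    using that(2)
  proof (induction rule: dec_induct)
    case (step j)
    then show ?case using assms that(1) unfolding is_part_def by (meson le_trans)
  qed simp
  have "{1..plen lam + 1} \<subseteq> {i. i \<ge> 1 \<and> lam i \<noteq> 0}"
    using anti ne by fastforce
  moreover have "finite {i. i \<ge> 1 \<and> lam i \<noteq> 0}"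
    using assms by (auto simp: is_part_def)
  ultimately have "card {1..plen lam + 1} \<le> plen lam"
    unfolding plen_def by (rule card_mono[rotated])
  then show False by simp
qed

text \<open>Adding a box and removing it again cancels in any row, so only the state between the two
  operations changes, and there the box to be removed has just been added.\<close>

lemma valid_path_ek:
  assumes t: "valid_path t" "length t = r" and k: "1 \<le> k" "k < r"
    and u: "snd (t ! (k - 1)) = fst (t ! k)" "fst (t ! k) \<ge> 1" and L: "L \<ge> 1"
  shows "valid_path (t[k - 1 := (fst (t ! (k - 1)), L), k := (L, snd (t ! k))])" (is "valid_path ?t")
proof -
  have nth: "?t ! j = (if j = k - 1 then (fst (t ! (k - 1)), L) else if j = k then (L, snd (t ! k)) else t ! j)"
    if "j < r" for j
    using that t k by (auto simp: nth_list_update)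
  have before: "pstate ?t j = pstate t j" if "j < k" for j
  proof -
    have "take j ?t = take j t" using that by simp
    then show ?thesis by (simp add: pstate_def)
  qed
  have h: "hstate ?t (k - 1) = hstate t (k - 1)"
    using before[of "k - 1"] k nth[of "k - 1"] by (simp add: hstate_def)
  have Sk: "Suc (k - 1) = k" using k by simp
  have mid: "pstate ?t k = addbox L (hstate t (k - 1))"
    using pstate_Suc[of "k - 1" ?t] k t h nth[of "k - 1"] unfolding Sk by simp
  have cancel: "rembox v (addbox v lam) = lam" if "v \<ge> 1" for v lam
    using that by (simp add: rembox_def addbox_def)
  have h1: "hstate t k = hstate t (k - 1)"
    using pstate_Suc[of "k - 1" t] k t u unfolding Sk by (simp add: hstate_def[of t k] cancel)
  have h2: "hstate ?t k = hstate t (k - 1)"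
  proof -
    have "k \<noteq> k - 1" using k by simp
    then have "fst (?t ! k) = L" using nth[of k] k by simp
    then show ?thesis unfolding hstate_def[of ?t k] mid using cancel[OF L] by simp
  qed
  have after: "pstate ?t j = pstate t j" if "Suc k \<le> j" "j \<le> r" for j
    using that
  proof (induction rule: dec_induct)
    case base
    show ?case using k t h1 h2 nth[of k] by (simp add: pstate_Suc)
  next
    case (step j)
    then have "?t ! j = t ! j" using nth[of j] by simp
    then show ?case using step t by (simp add: pstate_Suc hstate_def)
  qed
  show ?thesis
    unfolding valid_path_def
  proof (intro allI impI)
    fix j assume "j < length ?t"
    then have j: "j < r" using t by simp
    consider "j < k" | "j = k" | "Suc k \<le> j" by linarith
    then show "fst (?t ! j) = 0 \<or> 0 < pstate ?t j (fst (?t ! j))"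
    proof cases
      case 1
      then show ?thesis using before[OF 1] nth[OF j] t j by (auto simp: valid_path_def)
    next
      case 2
      then show ?thesis using mid nth[OF j] L k by (auto simp: addbox_def)
    next
      case 3
      then have "?t ! j = t ! j" using nth[OF j] by simp
      then show ?thesis using after[OF 3] t j by (auto simp: valid_path_def)
    qed
  qed
qed

text \<open>A diagram depends on its link data alone and not on the path, so the terms of the
  rerouted path are literally those of t with p (k + 1) = k. If that path is undefined there are no
  such terms, since this link requires the row added at k to be the row of positive index removed at
  k + 1.\<close>

lemma u_opt_ek:
  assumes t: "t \<in> Std r nu" and k: "1 \<le> k" "k < r"
  shows "u_opt n r (ek_path t k) =
    (\<Sum>(xs, p)\<in>{z \<in> link_data (removed t) (added t) r r. snd z (Suc k) = k}. diag r (links_col r xs p r))"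
proof -
  let ?a = "removed t" and ?b = "added t"
  have v: "valid_path t" "length t = r" using Std_valid_path[OF t] by auto
  have ab: "?b k = snd (t ! (k - 1))" "?a (Suc k) = fst (t ! k)" by (simp_all add: added_def removed_def)
  show ?thesis
  proof (cases "snd (t ! (k - 1)) = fst (t ! k) \<and> fst (t ! k) \<ge> 1")
    case False
    have empty: "{z \<in> link_data ?a ?b r r. snd z (Suc k) = k} = {}"
    proof (rule ccontr)
      assume "{z \<in> link_data ?a ?b r r. snd z (Suc k) = k} \<noteq> {}"
      then obtain xs p where "(xs, p) \<in> link_data ?a ?b r r" and pk: "p (Suc k) = k" by fastforce
      then have "predecessors ?a ?b r p" by (simp add: link_data_def)
      moreover have "Suc k \<in> {1..r}" using k by simp
      ultimately have "if ?a (Suc k) = 0 then p (Suc k) = 0 else ?b (p (Suc k)) = ?a (Suc k)"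
        unfolding predecessors_def by metis
      then show False using pk k False ab by (auto split: if_splits)
    qed
    show ?thesis unfolding empty using False by (auto simp: ek_path_def u_opt_def)
  next
    case True
    define L where "L = plen (hstate t (k - 1)) + 1"
    let ?t = "t[k - 1 := (fst (t ! (k - 1)), L), k := (L, snd (t ! k))]"
    have "u_opt n r (ek_path t k) = u_path n r ?t"
      using True by (simp add: ek_path_def u_opt_def L_def Let_def)
    also have "\<dots> = (\<Sum>(xs, p)\<in>link_data (removed ?t) (added ?t) r r. diag r (links_col r xs p r))"
      using v k True by (intro u_path_expansion valid_path_ek) (auto simp: L_def)
    also have "link_data (removed ?t) (added ?t) r r = link_data (?a(Suc k := L)) (?b(k := L)) r r"
    proof (rule link_data_cong)
      fix i assume i: "i \<in> {1..r}"
      then obtain j where j: "i = Suc j" "j < r" by (cases i) auto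
      have nth: "?t ! j = (if j = k - 1 then (fst (t ! (k - 1)), L) else if j = k then (L, snd (t ! k)) else t ! j)"
        using v k j by (auto simp: nth_list_update)
      show "removed ?t i = (?a(Suc k := L)) i" "added ?t i = (?b(k := L)) i"
        using k unfolding j removed_def added_def nth diff_Suc_1 by auto
    qed
    also have "\<dots> = {z \<in> link_data ?a ?b r r. snd z (Suc k) = k}"
    proof (rule link_data_marked)
      \<comment> \<open>\<open>hstate t (k - 1)\<close> is the state t(k - 1/2). Its row L is empty,
        and \<open>hstate_count\<close> turns this into the equality between removals up to k and
        additions up to k - 1.\<close>
      have "is_part (hstate t (k - 1))" using t k by (auto simp: Std_def)
      then have "hstate t (k - 1) L = 0" unfolding L_def by (rule is_part_plen)
      moreover have "L \<ge> 1" by (simp add: L_def)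
      ultimately show "card {i \<in> {1..k}. ?a i = L} = card {i \<in> {1..k - 1}. ?b i = L}"
        using hstate_count[OF v(1), of "k - 1" L] v k by simp
    qed (use k True ab in \<open>auto simp: L_def\<close>)
    finally show ?thesis .
  qed
qed

theorem theorem3p3:
  fixes n :: int and r k :: nat and nu :: "nat \<Rightarrow> nat" and t :: "(nat \<times> nat) list"
  assumes "r \<ge> 2"
    and "is_part nu" and "psize nu \<le> r"
    and "1 \<le> k" and "k \<le> r - 1"
    and "t \<in> Std r nu"
    and "swap_steps t k \<in> Std r nu"
  shows "pa_mult n r (u_path n r t) (s_adj r k)
         = u_path n r (swap_steps t k) + u_opt n r (ek_path t k)
           - u_opt n r (ek_path (swap_steps t k) k)"
proof -
  have k: "1 \<le> k" "k < r" using assms by auto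
  let ?t = "transpose k (Suc k)" and ?s = "swap_steps t k"
  let ?W = "link_data (removed t) (added t) r r" and ?W' = "link_data (removed ?s) (added ?s) r r"
  let ?d = "\<lambda>(xs, p). diag r (links_col r xs p r)"
  have v: "valid_path t" "length t = r" using Std_valid_path[OF assms(6)] by auto
  have v': "valid_path ?s" "length ?s = r" using Std_valid_path[OF assms(7)] by auto
  note E = u_path_expansion[OF v] and E' = u_path_expansion[OF v']
  \<comment> \<open>Interchanging the steps composes the labels with the transposition on {1..r},
    and link data see only labels there.\<close>
  have W': "?W' = link_data (removed t \<circ> ?t) (added t \<circ> ?t) r r"
    using k v by (intro link_data_cong)
      (auto simp: removed_def added_def swap_steps_def nth_list_update transpose_def)
  have free: "pa_mult n r (?d z) (s_adj r k) = ?d (conjugate k z)" if z: "z \<in> ?W" for z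
  proof -
    obtain xs p where zd: "z = (xs, p)" by (cases z)
    then have "pa_mult n r (?d z) (s_adj r k) = diag r (\<lambda>A B. links_col r xs p r A (?t ` B))"
      using diag_mult_s_adj[OF E(3)[of xs p] k] z by simp
    also have "\<dots> = ?d (conjugate k z)"
      unfolding links_col_transpose[OF k] zd by simp
    finally show ?thesis .
  qed
  have arc: "pa_mult n r (?d z) (s_adj r k) = ?d z" if z: "z \<in> ?W" "snd z (Suc k) = k" for z
  proof -
    obtain xs p where zd: "z = (xs, p)" by (cases z)
    then have "pa_mult n r (?d z) (s_adj r k) = diag r (\<lambda>A B. links_col r xs p r A (?t ` B))"
      using diag_mult_s_adj[OF E(3)[of xs p] k] z by simp
    also have "\<dots> = ?d z"
      using links_col_arc[OF k, of p] z(2) zd by simp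
    finally show ?thesis .
  qed
  have split: "sum f W = sum f {z \<in> W. snd z (Suc k) \<noteq> k} + sum f {z \<in> W. snd z (Suc k) = k}"
    if "finite W" for f :: "_ \<Rightarrow> pa" and W :: "(nat list \<times> (nat \<Rightarrow> nat)) set"
  proof -
    have "W = {z \<in> W. snd z (Suc k) \<noteq> k} \<union> {z \<in> W. snd z (Suc k) = k}" by auto
    then show ?thesis using that by (metis (no_types, lifting) sum.union_disjoint disjoint_iff finite_Un mem_Collect_eq)
  qed
  have "pa_mult n r (u_path n r t) (s_adj r k) = (\<Sum>z\<in>?W. pa_mult n r (?d z) (s_adj r k))"
    unfolding E(1) by (rule pa_mult_sum_left)
  also have "\<dots> = (\<Sum>z\<in>{z \<in> ?W. snd z (Suc k) \<noteq> k}. ?d (conjugate k z)) + sum ?d {z \<in> ?W. snd z (Suc k) = k}"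
    unfolding split[OF E(2)] using free arc by (intro arg_cong2[where f = "(+)"] sum.cong refl) auto
  also have "(\<Sum>z\<in>{z \<in> ?W. snd z (Suc k) \<noteq> k}. ?d (conjugate k z)) = sum ?d {z \<in> ?W'. snd z (Suc k) \<noteq> k}"
    unfolding W' by (rule sum.reindex_bij_betw[OF conjugate_bij[OF k refl refl]])
  \<comment> \<open>Completing this sum to the full expansion of the swapped path brings in its own
    terms with p (k + 1) = k, which must be taken off again; this is the origin of the negative
    term.\<close>
  also have "\<dots> = u_path n r ?s - sum ?d {z \<in> ?W'. snd z (Suc k) = k}"
    unfolding E'(1) split[OF E'(2)] by simp
  finally show ?thesis
    unfolding u_opt_ek[OF assms(6) k] u_opt_ek[OF assms(7) k] by (simp add: fun_eq_iff)
qed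

end
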